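(* Let $\xi=(\xi_1,\dots,\xi_N)$ have probability density $f$ on $\mathbb R^N$, let $\mathbf Q\subset\mathbb R^n$ be Borel, $N\ge n$, $k\in\{1,\dots,N\}$, and let $\mathbf Z=(\mathbf z_1^*,\dots,\mathbf z_N^* )$ be vectors in $\mathbb R^n$ such that $\mathbf z_1^*,\dots,\mathbf z_n^*$ form a basis of $\mathbb R^n$. Assume that for each $j=1,\dots,n$ the density $f$ is differentiable with respect to $r_j$ and $\Phi_{kj}(\mathbf r)=\partial(r_kf)/\partial r_j$ is summable on $\mathbb R^N$. Then $h_k$ is differentiable at $\mathbf z_k^*$ and $$\nabla h_k(\mathbf z_k^* )=\sum_{j=1}^n\sum_{i=1}^n\frac{\partial h_k}{\partial\mathbf z_j^*}\,\langle\mathbf e^j,\mathbf e^i\rangle\,\mathbf z_i^*,$$ where $\{\mathbf e^1,\dots,\mathbf e^n\}$ is the dual basis of $\{\mathbf z_1^*,\dots,\mathbf z_n^*\}$ (i.e. $\langle\mathbf e^i,\mathbf z_l^*\rangle=\delta_{il}$) and $\frac{\partial h_k}{\partial\mathbf z_j^*}=\frac{d}{d\varepsilon}h_k(\mathbf z_k^*+\varepsilon\mathbf z_j^* )|_{\varepsilon=0}$.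
   Context: For vectors $\mathbf z_1,\dots,\mathbf z_N\in\mathbb R^n$ put $g(\mathbf z_1,\dots,\mathbf z_N)=\mathbf P\big(\sum_{i=1}^N\xi_i\mathbf z_i\in\mathbf Q\big)$. Given $\mathbf Z=(\mathbf z_1^*,\dots,\mathbf z_N^* )$ and fixed $k$, define $h_k(\mathbf z)=g(\mathbf z_1^*,\dots,\mathbf z_{k-1}^*,\mathbf z,\mathbf z_{k+1}^*,\dots,\mathbf z_N^* )$, $\mathbf z\in\mathbb R^n$. $\langle\cdot,\cdot\rangle$ is the Euclidean inner product. *)

theory Defs
  imports "HOL-Analysis.Analysis" "HOL-Probability.Probability"
begin

definition RN :: "nat \<Rightarrow> (nat \<Rightarrow> real) measure" where
  "RN N = PiM {1..N} (\<lambda>_. lborel)"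

definition gfun :: "'a measure \<Rightarrow> ('a \<Rightarrow> nat \<Rightarrow> real) \<Rightarrow> nat \<Rightarrow> ('b::euclidean_space) set
    \<Rightarrow> (nat \<Rightarrow> 'b) \<Rightarrow> real" where
  "gfun M \<xi> N Q z = measure M {\<omega> \<in> space M. (\<Sum>i\<in>{1..N}. \<xi> \<omega> i *\<^sub>R z i) \<in> Q}"

definition hfun :: "'a measure \<Rightarrow> ('a \<Rightarrow> nat \<Rightarrow> real) \<Rightarrow> nat \<Rightarrow> ('b::euclidean_space) set
    \<Rightarrow> (nat \<Rightarrow> 'b) \<Rightarrow> nat \<Rightarrow> 'b \<Rightarrow> real" where
  "hfun M \<xi> N Q Z k z = gfun M \<xi> N Q (Z(k := z))"

definition pderiv_coord :: "((nat \<Rightarrow> real) \<Rightarrow> real) \<Rightarrow> nat \<Rightarrow> (nat \<Rightarrow> real) \<Rightarrow> real" where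
  "pderiv_coord F j r = deriv (\<lambda>t. F (r(j := t))) (r j)"

definition Phi :: "((nat \<Rightarrow> real) \<Rightarrow> real) \<Rightarrow> nat \<Rightarrow> nat \<Rightarrow> (nat \<Rightarrow> real) \<Rightarrow> real" where
  "Phi f k j = pderiv_coord (\<lambda>r. r k * f r) j"

definition dir_deriv :: "('b::real_normed_vector \<Rightarrow> real) \<Rightarrow> 'b \<Rightarrow> 'b \<Rightarrow> real" where
  "dir_deriv h x v = deriv (\<lambda>\<epsilon>. h (x + \<epsilon> *\<^sub>R v)) 0"

end

theory Submission
  imports Defs
begin

text \<open>
  Moving the k-th vector by v = sum of a(j) Z(j), where a(j) = <e(j), v>, is the same as replacing
  the coordinates r(j) of the random vector by r(j) + a(j) r(k), j = 1..n. This linear map is a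
  composition of the maps that change one coordinate only: shears for j \<noteq> k and, applied last, a
  dilation for j = k. The change of variables moves such a map from the indicator of Q to the
  density. Along the j-th coordinate line the new density differs from the old one by a difference
  quotient of r(k) f, so by the fundamental theorem of calculus the difference is an average of
  \<open>\<Phi>\<close>(k,j) over nearby points. Continuity of affine substitutions in L1 then makes the error
  o(a(j)) in L1, first on each line and, by dominated convergence over the lines, on the whole space.
  Composing the maps shows that h is differentiable with gradient -sum of
  (integral of \<open>\<Phi>\<close>(k,j) over the event) e(j); the stated formula is its expansion in
  the basis Z.
\<close>

subsection \<open>Continuity of affine substitutions in L1\<close>

text \<open>The indicator of a Borel set Q has no smoothness, so all regularity has to come from the
  density; and the density offers little: \<Phi>(k,j) exists everywhere and is integrable, but it
  need not be continuous, and no integrability of the partial derivatives of f is given.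
  Differentiating under the integral with a pointwise majorant is therefore out of reach, and every
  estimate is made in L1 norm.

  This choice also serves the composition. Once some coordinates have been changed, the function
  tested against f is the indicator composed with a map depending on v. An L1 estimate holds
  uniformly over all test functions bounded by 1, so a moving test function does no harm.

  A second obstacle is that a shear displaces the points of a line by t r(k), which is unbounded
  across lines. No rate of convergence is common to all lines. Hence the estimates on a line come in
  pairs: smallness, at a rate depending on the line, and a crude bound whose constant is the same
  for all lines and provides the domination.\<close>

definition L1_affine_dist :: "(real \<Rightarrow> real) \<Rightarrow> real \<Rightarrow> real \<Rightarrow> real" where
  "L1_affine_dist g b s = (LINT y|lborel. \<bar>g (s + b * y) - g y\<bar>)"

lemma integral_abs_affine:
  fixes g :: "real \<Rightarrow> real"
  assumes "b > 0"
  shows "(LINT y|lborel. \<bar>g (s + b * y)\<bar>) = (LINT y|lborel. \<bar>g y\<bar>) / b"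
  using lborel_integral_real_affine[of b "\<lambda>y. \<bar>g y\<bar>" s] assms by simp

text \<open>The constant 3 is 1 + 2: the unmoved error f - h counts once, the moved one costs a
  factor 1/b \<le> 2.\<close>

lemma L1_affine_dist_approx:
  assumes f: "integrable lborel f" and h: "integrable lborel h" and b: "b \<ge> 1/2"
  shows "L1_affine_dist f b s \<le> L1_affine_dist h b s + 3 * (LINT y|lborel. \<bar>f y - h y\<bar>)"
proof -
  have b0: "b \<noteq> 0" "b > 0" using b by auto
  note fa = lborel_integrable_real_affine[OF f b0(1), of s] 
  note ha = lborel_integrable_real_affine[OF h b0(1), of s]
  have d: "(LINT y|lborel. \<bar>f (s + b * y) - h (s + b * y)\<bar>) \<le> 2 * (LINT y|lborel. \<bar>f y - h y\<bar>)"
  proof -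
    have nn: "0 \<le> (LINT y|lborel. \<bar>f y - h y\<bar>)" by simp
    have "1 / b \<le> 2" using b by (simp add: field_simps)
    from mult_right_mono[OF this nn] show ?thesis
      using integral_abs_affine[OF b0(2), of "\<lambda>y. f y - h y" s] by simp
  qed
  have "L1_affine_dist f b s \<le> (LINT y|lborel. \<bar>h (s + b * y) - h y\<bar> + \<bar>f y - h y\<bar> + \<bar>f (s + b * y) - h (s + b * y)\<bar>)"
    unfolding L1_affine_dist_def using f h fa ha by (intro integral_mono) auto
  also have "\<dots> = L1_affine_dist h b s + (LINT y|lborel. \<bar>f y - h y\<bar>) + (LINT y|lborel. \<bar>f (s + b * y) - h (s + b * y)\<bar>)"
    unfolding L1_affine_dist_def using f h fa ha by simp
  finally show ?thesis using d by simp
qed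

text \<open>Continuity under affine substitutions is closed under L1 approximation, because the
  error in \<open>L1_affine_dist_approx\<close> does not depend on m. The induction in
  \<open>L1_affine_dist_tendsto\<close> uses this twice: to pass from open sets to Borel sets, and
  for pointwise limits.\<close>

lemma L1_affine_dist_tendsto_approx:
  assumes f: "integrable lborel f" and b: "\<And>m. b m \<ge> 1/2"
    and ex: "\<And>\<eta>. \<eta> > 0 \<Longrightarrow> \<exists>h. integrable lborel h \<and> (LINT y|lborel. \<bar>f y - h y\<bar>) \<le> \<eta> \<and>
        (\<lambda>m::nat. L1_affine_dist h (b m) (s m)) \<longlonglongrightarrow> 0"
  shows "(\<lambda>m. L1_affine_dist f (b m) (s m)) \<longlonglongrightarrow> 0"
proof (rule LIMSEQ_I)
  fix r :: real assume r: "0 < r"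
  obtain h where h: "integrable lborel h" "(LINT y|lborel. \<bar>f y - h y\<bar>) \<le> r/6"
    "(\<lambda>m::nat. L1_affine_dist h (b m) (s m)) \<longlonglongrightarrow> 0"
    using ex[of "r/6"] r by auto
  from LIMSEQ_D[OF h(3), of "r/2"] r obtain n0 where n0: "\<And>n. n \<ge> n0 \<Longrightarrow> norm (L1_affine_dist h (b n) (s n) - 0) < r/2"
    by auto
  show "\<exists>no. \<forall>n\<ge>no. norm (L1_affine_dist f (b n) (s n) - 0) < r"
  proof (intro exI allI impI)
    fix n assume "n \<ge> n0"
    from n0[OF this] L1_affine_dist_approx[OF f h(1) b, of n "s n"] h(2)
    have "L1_affine_dist f (b n) (s n) < r" by simp
    moreover have "L1_affine_dist f (b n) (s n) \<ge> 0" by (simp add: L1_affine_dist_def)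
    ultimately show "norm (L1_affine_dist f (b n) (s n) - 0) < r" by simp
  qed
qed

text \<open>A Scheffe-type argument. With u the indicator and u' its moved copy, |u' - u| = (u' - u)
  + 2 max 0 (u - u'). The first term integrates to (1/b - 1) times the measure of U. The second is
  dominated by u and tends to 0 at every point: inside U by openness, outside because u vanishes
  there. Nothing about the boundary of U is required.\<close>

lemma L1_affine_dist_open_tendsto:
  fixes U :: "real set"
  assumes U: "open U" "emeasure lborel U < \<infinity>" and b: "\<And>m. b m \<ge> 1/2" "b \<longlonglongrightarrow> 1" and s: "s \<longlonglongrightarrow> 0"
  shows "(\<lambda>m::nat. L1_affine_dist (indicator U) (b m) (s m)) \<longlonglongrightarrow> 0"
proof -
  let ?u = "indicator U :: real \<Rightarrow> real"
  have Ub[measurable]: "U \<in> sets borel" using U by simp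
  have iu: "integrable lborel ?u" using U by auto
  have b0: "b m \<noteq> 0" "b m > 0" for m using b(1)[of m] by linarith+
  note iua = lborel_integrable_real_affine[OF iu b0(1)]
  define P where "P m = (LINT y|lborel. max 0 (?u y - ?u (s m + b m * y)))" for m
  have "(\<lambda>m. LINT y|lborel. max 0 (?u y - ?u (s m + b m * y))) \<longlonglongrightarrow> (LINT y|(lborel::real measure). (0::real))"
  proof (rule integral_dominated_convergence[where w="?u" and s="\<lambda>m y. max 0 (?u y - ?u (s m + b m * y))" and f="\<lambda>_. 0"])
    show "AE x in lborel. (\<lambda>m. max 0 (?u x - ?u (s m + b m * x))) \<longlonglongrightarrow> 0"
    proof (intro AE_I2)
      fix x :: real
      show "(\<lambda>m. max 0 (?u x - ?u (s m + b m * x))) \<longlonglongrightarrow> 0"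
      proof (cases "x \<in> U")
        case True
        have "(\<lambda>m. s m + b m * x) \<longlonglongrightarrow> 0 + 1 * x" by (intro tendsto_intros b s)
        from topological_tendstoD[OF this U(1)] True
        have "\<forall>\<^sub>F m in sequentially. s m + b m * x \<in> U" by simp
        then have "\<forall>\<^sub>F m in sequentially. max 0 (?u x - ?u (s m + b m * x)) = 0"
          by eventually_elim (simp add: True)
        then show ?thesis by (rule tendsto_eventually)
      next
        case False
        then have "max 0 (?u x - ?u (s m + b m * x)) = 0" for m
          by (auto simp: indicator_def)
        then show ?thesis by simp
      qed
    qed
    show "AE x in lborel. norm (max 0 (?u x - ?u (s m + b m * x))) \<le> ?u x" for m
      by (auto simp: indicator_def)
  qed (use iu in auto)
  then have P0: "P \<longlonglongrightarrow> 0" unfolding P_def[abs_def] by simp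
  have ip: "integrable lborel (\<lambda>y. max 0 (?u y - ?u (s m + b m * y)))" for m
    using iu iua[of "s m" m] by auto
  have eq: "L1_affine_dist ?u (b m) (s m) = (LINT y|lborel. ?u y) / b m - (LINT y|lborel. ?u y) + 2 * P m" for m
  proof -
    have "L1_affine_dist ?u (b m) (s m) = (LINT y|lborel. (?u (s m + b m * y) - ?u y) + 2 * max 0 (?u y - ?u (s m + b m * y)))"
      unfolding L1_affine_dist_def by (intro Bochner_Integration.integral_cong) (auto simp: indicator_def)
    also have "\<dots> = (LINT y|lborel. ?u (s m + b m * y)) - (LINT y|lborel. ?u y) + 2 * P m"
      unfolding P_def using iu iua[of "s m" m] ip by simp
    also have "(LINT y|lborel. ?u (s m + b m * y)) = (LINT y|lborel. ?u y) / b m"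
      using integral_abs_affine[OF b0(2), of "?u" "s m" m] by simp
    finally show ?thesis .
  qed
  have "(\<lambda>m. (LINT y|lborel. ?u y) / b m - (LINT y|lborel. ?u y) + 2 * P m) \<longlonglongrightarrow> (LINT y|lborel. ?u y) / 1 - (LINT y|lborel. ?u y) + 2 * 0"
    by (intro tendsto_intros b P0) auto
  then show ?thesis unfolding eq by simp
qed

lemma L1_affine_dist_tendsto:
  fixes g :: "real \<Rightarrow> real"
  assumes g: "integrable lborel g" and b: "\<And>m. b m \<ge> 1/2" "b \<longlonglongrightarrow> 1" and s: "s \<longlonglongrightarrow> 0"
  shows "(\<lambda>m::nat. L1_affine_dist g (b m) (s m)) \<longlonglongrightarrow> 0"
  using g
proof (induction rule: integrable_induct)
  case (base A c)
  have A: "A \<in> sets lborel" "emeasure lborel A < \<infinity>" using base by auto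
  show ?case
  proof (rule L1_affine_dist_tendsto_approx[OF _ b(1)])
    show "integrable lborel (\<lambda>x. indicator A x *\<^sub>R c)" using base by auto
    fix \<eta> :: real assume \<eta>: "\<eta> > 0"
    have "A \<in> sets lebesgue" using A by auto
    \<comment> \<open>Outer regularity replaces A by an open set. The + 1 in the denominator covers
      c = 0.\<close>
    obtain U where U: "open U" "A \<subseteq> U" "U - A \<in> lmeasurable" "emeasure lebesgue (U - A) < ennreal (\<eta> / (\<bar>c\<bar> + 1))"
      using sets_lebesgue_outer_open[OF \<open>A \<in> sets lebesgue\<close>, of "\<eta> / (\<bar>c\<bar> + 1)"] \<eta> by auto
    have [measurable]: "U \<in> sets borel" "A \<in> sets borel" using U A by auto
    have UA: "emeasure lborel (U - A) < ennreal (\<eta> / (\<bar>c\<bar> + 1))" using U(4) by simp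
    have "emeasure lborel U = emeasure lborel A + emeasure lborel (U - A)"
      using U(2) by (subst plus_emeasure) (auto simp: Un_absorb1)
    also have "\<dots> < \<infinity>" using A UA by (auto simp: less_top[symmetric] ennreal_add_eq_top)
    finally have fU: "emeasure lborel U < \<infinity>" .
    let ?h = "\<lambda>y. indicator U y *\<^sub>R c"
    have ih: "integrable lborel ?h" using fU by auto
    have "L1_affine_dist ?h (b m) (s m) = \<bar>c\<bar> * L1_affine_dist (indicator U) (b m) (s m)" for m
    proof -
      have "\<bar>indicator U x *\<^sub>R c - indicator U y *\<^sub>R c\<bar> = \<bar>c\<bar> * \<bar>indicator U x - indicator U y :: real\<bar>" for x y
        by (simp add: abs_mult[symmetric] algebra_simps)
      then show ?thesis unfolding L1_affine_dist_def by simp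
    qed
    moreover have "(\<lambda>m. \<bar>c\<bar> * L1_affine_dist (indicator U) (b m) (s m)) \<longlonglongrightarrow> 0"
      by (intro tendsto_mult_right_zero L1_affine_dist_open_tendsto U(1) fU b s)
    ultimately have lim: "(\<lambda>m. L1_affine_dist ?h (b m) (s m)) \<longlonglongrightarrow> 0" by simp
    have "(LINT y|lborel. \<bar>indicator A y *\<^sub>R c - indicator U y *\<^sub>R c\<bar>) = (LINT y|lborel. indicator (U - A) y * \<bar>c\<bar>)"
      using U(2) by (intro Bochner_Integration.integral_cong) (auto simp: indicator_def)
    also have "\<dots> = measure lborel (U - A) * \<bar>c\<bar>" by simp
    also have "\<dots> \<le> (\<eta> / (\<bar>c\<bar> + 1)) * \<bar>c\<bar>"
    proof (intro mult_right_mono)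
      show "measure lborel (U - A) \<le> \<eta> / (\<bar>c\<bar> + 1)"
        unfolding measure_def using UA \<eta> by (intro enn2real_leI) auto
    qed auto
    also have "\<dots> \<le> \<eta>" using \<eta> by (simp add: field_simps)
    finally show "\<exists>h. integrable lborel h \<and> (LINT y|lborel. \<bar>indicator A y *\<^sub>R c - h y\<bar>) \<le> \<eta> \<and>
        (\<lambda>m::nat. L1_affine_dist h (b m) (s m)) \<longlonglongrightarrow> 0"
      using ih lim by (intro exI[of _ ?h]) auto
  qed
next
  case (add f g)
  have b0: "b m \<noteq> 0" for m using b(1)[of m] by linarith
  note fa = lborel_integrable_real_affine[OF add(1) b0]
  note ga = lborel_integrable_real_affine[OF add(2) b0]
  have "(\<lambda>m. L1_affine_dist f (b m) (s m) + L1_affine_dist g (b m) (s m)) \<longlonglongrightarrow> 0 + 0"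
    by (intro tendsto_intros add.IH)
  then have lim: "(\<lambda>m. L1_affine_dist f (b m) (s m) + L1_affine_dist g (b m) (s m)) \<longlonglongrightarrow> 0" by simp
  show ?case
  proof (rule tendsto_sandwich[OF _ _ tendsto_const lim])
    have "L1_affine_dist (\<lambda>x. f x + g x) (b m) (s m) \<le> L1_affine_dist f (b m) (s m) + L1_affine_dist g (b m) (s m)" for m
    proof -
      have "L1_affine_dist (\<lambda>x. f x + g x) (b m) (s m) \<le> 
        (LINT y|lborel. \<bar>f (s m + b m * y) - f y\<bar> + \<bar>g (s m + b m * y) - g y\<bar>)"
        unfolding L1_affine_dist_def using add(1,2) fa[of "s m" m] ga[of "s m" m] by (intro integral_mono) auto
      then show ?thesis
        unfolding L1_affine_dist_def using add(1,2) fa[of "s m" m] ga[of "s m" m] by simp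
    qed
    then show "\<forall>\<^sub>F m in sequentially. L1_affine_dist (\<lambda>x. f x + g x) (b m) (s m) \<le> L1_affine_dist f (b m) (s m) + L1_affine_dist g (b m) (s m)"
      by simp
  qed (auto simp: L1_affine_dist_def)
next
  case (lim f h)
  show ?case
  proof (rule L1_affine_dist_tendsto_approx[OF lim.hyps(4) b(1)])
    fix \<eta> :: real assume \<eta>: "\<eta> > 0"
    \<comment> \<open>The induction rule supplies |h i x| \<le> 2 |f x|, whence the majorant 3
      |f|.\<close>
    have "(\<lambda>i. LINT y|lborel. \<bar>f y - h i y\<bar>) \<longlonglongrightarrow> (LINT y|(lborel::real measure). (0::real))"
    proof (rule integral_dominated_convergence[where w="\<lambda>y. 3 * \<bar>f y\<bar>"])
      show "AE x in lborel. (\<lambda>i. \<bar>f x - h i x\<bar>) \<longlonglongrightarrow> 0"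
      proof (intro AE_I2)
        fix x :: real
        have "(\<lambda>i. \<bar>f x - h i x\<bar>) \<longlonglongrightarrow> \<bar>f x - f x\<bar>"
          using lim.hyps(2) by (intro tendsto_intros) auto
        then show "(\<lambda>i. \<bar>f x - h i x\<bar>) \<longlonglongrightarrow> 0" by simp
      qed
      show "AE x in lborel. norm \<bar>f x - h i x\<bar> \<le> 3 * \<bar>f x\<bar>" for i
      proof (intro AE_I2)
        fix x :: real
        show "norm \<bar>f x - h i x\<bar> \<le> 3 * \<bar>f x\<bar>" using lim.hyps(3)[of x i] by auto
      qed
    qed (use lim.hyps in auto)
    then have "(\<lambda>i. LINT y|lborel. \<bar>f y - h i y\<bar>) \<longlonglongrightarrow> 0" by simp
    from LIMSEQ_D[OF this \<eta>] obtain i where "(LINT y|lborel. \<bar>f y - h i y\<bar>) < \<eta>" by auto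
    then show "\<exists>h. integrable lborel h \<and> (LINT y|lborel. \<bar>f y - h y\<bar>) \<le> \<eta> \<and>
        (\<lambda>m::nat. L1_affine_dist h (b m) (s m)) \<longlonglongrightarrow> 0"
      using lim.hyps lim.IH by (intro exI[of _ "h i"]) auto
  qed
qed

text \<open>The sequential statement is turned into one uniform in b and s, since later both
  parameters depend on a variable \<tau> in [0,1] and one neighbourhood must serve all
  \<tau>.\<close>

lemma L1_affine_dist_small:
  fixes g :: "real \<Rightarrow> real"
  assumes g: "integrable lborel g" and "\<eta> > 0"
  obtains \<delta> where "\<delta> > 0" "\<delta> \<le> 1/2" "\<And>b s. \<bar>b - 1\<bar> < \<delta> \<Longrightarrow> \<bar>s\<bar> < \<delta> \<Longrightarrow> L1_affine_dist g b s < \<eta>"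
proof -
  have "\<exists>\<delta>>0. \<delta> \<le> 1/2 \<and> (\<forall>b s. \<bar>b - 1\<bar> < \<delta> \<longrightarrow> \<bar>s\<bar> < \<delta> \<longrightarrow> L1_affine_dist g b s < \<eta>)"
  proof (rule ccontr)
    assume neg: "\<not> ?thesis"
    \<comment> \<open>The radius 1 / (m + 2) is at most 1/2, which keeps b m \<ge> 1/2 as the
      sequential lemma demands.\<close>
    have "\<exists>b s. \<bar>b - 1\<bar> < 1 / (real m + 2) \<and> \<bar>s\<bar> < 1 / (real m + 2) \<and> \<not> L1_affine_dist g b s < \<eta>" for m :: nat
    proof -
      have "1 / (real m + 2) > 0" "1 / (real m + 2) \<le> 1/2" by (auto simp: field_simps)
      then show ?thesis using neg by blast
    qed
    then obtain b s where bs: "\<And>m::nat. \<bar>b m - 1\<bar> < 1 / (real m + 2)" "\<And>m. \<bar>s m\<bar> < 1 / (real m + 2)"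
      "\<And>m. \<not> L1_affine_dist g (b m) (s m) < \<eta>" by metis
    have z: "(\<lambda>m. 1 / (real m + 2)) \<longlonglongrightarrow> 0" using LIMSEQ_ignore_initial_segment[OF lim_1_over_n, of 2] by (simp add: add.commute)
    have "(\<lambda>m. b m - 1) \<longlonglongrightarrow> 0" using bs(1)
      by (intro Lim_null_comparison[OF _ z] always_eventually) (auto intro: less_imp_le)
    then have "b \<longlonglongrightarrow> 1" by (simp add: LIM_zero_iff)
    moreover have "s \<longlonglongrightarrow> 0" using bs(2)
      by (intro Lim_null_comparison[OF _ z] always_eventually) (auto intro: less_imp_le)
    moreover have "b m \<ge> 1/2" for m
    proof -
      have "1 / (real m + 2) \<le> 1/2" by (auto simp: field_simps)
      then show ?thesis using bs(1)[of m] by linarith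
    qed
    ultimately have "(\<lambda>m. L1_affine_dist g (b m) (s m)) \<longlonglongrightarrow> 0"
      using L1_affine_dist_tendsto[OF g] by blast
    from LIMSEQ_D[OF this \<open>\<eta> > 0\<close>] bs(3) show False by (auto simp: abs_less_iff)
  qed
  then show ?thesis using that by blast
qed

subsection \<open>The infinitesimal shear on a single coordinate line\<close>

text \<open>The factor a stands for the reciprocal Jacobian, which stays fixed while b and s move
  along the path of substitutions, so a and b are separate parameters. The value is extended so that
  bounds make sense before integrability is known.\<close>

definition L1_scaled_dist :: "(real \<Rightarrow> real) \<Rightarrow> real \<Rightarrow> real \<Rightarrow> real \<Rightarrow> ennreal" where
  "L1_scaled_dist p a b s = (\<integral>\<^sup>+y. ennreal \<bar>a * p (s + b * y) - p y\<bar> \<partial>lborel)"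

lemma L1_scaled_dist_le:
  assumes p: "integrable lborel p" and a: "0 \<le> a" "a \<le> 2" and b: "b \<ge> 1/2"
  shows "L1_scaled_dist p a b s \<le> ennreal (2 * L1_affine_dist p b s + \<bar>a - 1\<bar> * (LINT y|lborel. \<bar>p y\<bar>))"
proof -
  have b0: "b \<noteq> 0" using b by auto
  note pa = lborel_integrable_real_affine[OF p b0, of s]
  have "L1_scaled_dist p a b s \<le> (\<integral>\<^sup>+y. ennreal (2 * \<bar>p (s + b * y) - p y\<bar> + \<bar>a - 1\<bar> * \<bar>p y\<bar>) \<partial>lborel)"
    unfolding L1_scaled_dist_def
  proof (intro nn_integral_mono ennreal_leI)
    fix y
    have "a * p (s + b * y) - p y = a * (p (s + b * y) - p y) + (a - 1) * p y" by (simp add: algebra_simps)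
    then have "\<bar>a * p (s + b * y) - p y\<bar> \<le> \<bar>a * (p (s + b * y) - p y)\<bar> + \<bar>(a - 1) * p y\<bar>" by linarith
    also have "\<dots> \<le> 2 * \<bar>p (s + b * y) - p y\<bar> + \<bar>a - 1\<bar> * \<bar>p y\<bar>"
      unfolding abs_mult using a by (intro add_mono mult_right_mono) auto
    finally show "\<bar>a * p (s + b * y) - p y\<bar> \<le> 2 * \<bar>p (s + b * y) - p y\<bar> + \<bar>a - 1\<bar> * \<bar>p y\<bar>" .
  qed
  also have "\<dots> = ennreal (LINT y|lborel. 2 * \<bar>p (s + b * y) - p y\<bar> + \<bar>a - 1\<bar> * \<bar>p y\<bar>)"
    using p pa by (intro nn_integral_eq_integral) auto
  also have "(LINT y|lborel. 2 * \<bar>p (s + b * y) - p y\<bar> + \<bar>a - 1\<bar> * \<bar>p y\<bar>) =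
    2 * L1_affine_dist p b s + \<bar>a - 1\<bar> * (LINT y|lborel. \<bar>p y\<bar>)"
    unfolding L1_affine_dist_def using p pa by simp
  finally show ?thesis .
qed

lemma L1_scaled_dist_small:
  assumes p: "integrable lborel p" and \<eta>: "\<eta> > 0"
  obtains \<delta> where "\<delta> > 0" "\<delta> \<le> 1/2"
    "\<And>a b s. \<bar>a - 1\<bar> < \<delta> \<Longrightarrow> \<bar>b - 1\<bar> < \<delta> \<Longrightarrow> \<bar>s\<bar> < \<delta> \<Longrightarrow> L1_scaled_dist p a b s \<le> ennreal \<eta>"
proof -
  define I where "I = (LINT y|lborel. \<bar>p y\<bar>)"
  have I: "I \<ge> 0" unfolding I_def by simp
  obtain \<delta> where d: "\<delta> > 0" "\<delta> \<le> 1/2" "\<And>b s. \<bar>b - 1\<bar> < \<delta> \<Longrightarrow> \<bar>s\<bar> < \<delta> \<Longrightarrow> L1_affine_dist p b s < \<eta> / 4"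
    using L1_affine_dist_small[OF p, of "\<eta>/4"] \<eta> by auto
  \<comment> \<open>Each term receives half of \<eta>: twice \<eta> / 4 from the affine distance,
    and |a - 1| I \<le> \<eta> / 2 from the factor. I + 1 avoids a zero denominator.\<close>
  show ?thesis
  proof (rule that[of "min \<delta> (\<eta> / (2 * (I + 1)))"])
    fix a b s assume ab: "\<bar>a - 1\<bar> < min \<delta> (\<eta> / (2 * (I + 1)))" "\<bar>b - 1\<bar> < min \<delta> (\<eta> / (2 * (I + 1)))" "\<bar>s\<bar> < min \<delta> (\<eta> / (2 * (I + 1)))"
    have "L1_scaled_dist p a b s \<le> ennreal (2 * L1_affine_dist p b s + \<bar>a - 1\<bar> * I)"
      unfolding I_def using ab d(2) by (intro L1_scaled_dist_le p) (auto simp: abs_if split: if_splits)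
    also have "\<dots> \<le> ennreal \<eta>"
    proof (intro ennreal_leI)
      have "\<bar>a - 1\<bar> * I \<le> (\<eta> / (2 * (I + 1))) * I" using ab I by (intro mult_right_mono) auto
      also have "\<dots> \<le> \<eta> / 2" using \<eta> I by (simp add: field_simps)
      finally show "2 * L1_affine_dist p b s + \<bar>a - 1\<bar> * I \<le> \<eta>" using d(3)[of b s] ab by simp
    qed
    finally show "L1_scaled_dist p a b s \<le> ennreal \<eta>" .
  next
    show "min \<delta> (\<eta> / (2 * (I + 1))) \<le> 1 / 2" using d(2) by (rule min.coboundedI1)
  qed (use d \<eta> I in auto)
qed

text \<open>5 = 2 * 2 + 1: a \<le> 2 and 1/b \<le> 2 for the moved term, 1 for the unmoved one. The
  bound is uniform in the parameters, as the domination over lines requires.\<close>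

lemma L1_scaled_dist_bound:
  assumes [measurable]: "p \<in> borel_measurable borel" and a: "0 \<le> a" "a \<le> 2" and b: "b \<ge> 1/2"
  shows "L1_scaled_dist p a b s \<le> 5 * (\<integral>\<^sup>+y. ennreal \<bar>p y\<bar> \<partial>lborel)"
proof -
  have b0: "b \<noteq> 0" using b by auto
  have "L1_scaled_dist p a b s \<le> (\<integral>\<^sup>+y. ennreal 2 * ennreal \<bar>p (s + b * y)\<bar> + ennreal \<bar>p y\<bar> \<partial>lborel)"
    unfolding L1_scaled_dist_def
  proof (intro nn_integral_mono)
    fix y
    have "\<bar>a * p (s + b * y) - p y\<bar> \<le> \<bar>a * p (s + b * y)\<bar> + \<bar>p y\<bar>" by linarith
    also have "\<dots> \<le> 2 * \<bar>p (s + b * y)\<bar> + \<bar>p y\<bar>"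
      unfolding abs_mult using a by (intro add_mono mult_right_mono) auto
    finally show "ennreal \<bar>a * p (s + b * y) - p y\<bar> \<le> ennreal 2 * ennreal \<bar>p (s + b * y)\<bar> + ennreal \<bar>p y\<bar>"
      by (simp add: ennreal_leI flip: ennreal_mult' ennreal_plus del: ennreal_numeral)
  qed
  also have "\<dots> = ennreal 2 * (\<integral>\<^sup>+y. ennreal \<bar>p (s + b * y)\<bar> \<partial>lborel) + (\<integral>\<^sup>+y. ennreal \<bar>p y\<bar> \<partial>lborel)"
    by (subst nn_integral_add) (auto simp: nn_integral_cmult)
  also have "ennreal 2 * (\<integral>\<^sup>+y. ennreal \<bar>p (s + b * y)\<bar> \<partial>lborel) \<le> 
     ennreal 4 * (ennreal \<bar>b\<bar> * (\<integral>\<^sup>+y. ennreal \<bar>p (s + b * y)\<bar> \<partial>lborel))"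
  proof -
    have "ennreal 2 \<le> ennreal 4 * ennreal \<bar>b\<bar>"
      using b by (subst ennreal_mult[symmetric]) (auto intro!: ennreal_leI simp del: ennreal_numeral)
    from mult_right_mono[OF this] show ?thesis by (simp add: mult.assoc del: ennreal_numeral)
  qed
  also have "ennreal \<bar>b\<bar> * (\<integral>\<^sup>+y. ennreal \<bar>p (s + b * y)\<bar> \<partial>lborel) = (\<integral>\<^sup>+y. ennreal \<bar>p y\<bar> \<partial>lborel)"
    using nn_integral_real_affine[of "\<lambda>y. ennreal \<bar>p y\<bar>" b s] b0 by simp
  also have "ennreal 4 * (\<integral>\<^sup>+y. ennreal \<bar>p y\<bar> \<partial>lborel) + (\<integral>\<^sup>+y. ennreal \<bar>p y\<bar> \<partial>lborel) = 5 * (\<integral>\<^sup>+y. ennreal \<bar>p y\<bar> \<partial>lborel)"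
  proof -
    have "(5::ennreal) = ennreal 4 + 1" by (simp flip: ennreal_1 ennreal_plus add: ennreal_numeral[symmetric] del: ennreal_numeral)
    then show ?thesis by (simp only: distrib_right mult_1_left)
  qed
  finally show ?thesis by (simp add: add_right_mono)
qed

text \<open>The derivative p need not be continuous. The gauge integral integrates any everywhere
  existing derivative, and Lebesgue integrability of p identifies this value with the Lebesgue
  integral. For h = 0 the affine substitution degenerates, but the integrand is constant on
  [0,1].\<close>

lemma integral_FTC_unit_interval:
  fixes u p :: "real \<Rightarrow> real"
  assumes der: "\<And>x. (u has_real_derivative p x) (at x)" and p: "integrable lborel p"
  shows "integrable lborel (\<lambda>\<tau>. indicator {0..1} \<tau> * p (y + \<tau> * h))"
    and "u (y + h) - u y = h * (LINT \<tau>|lborel. indicator {0..1} \<tau> * p (y + \<tau> * h))"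
proof -
  show int: "integrable lborel (\<lambda>\<tau>. indicator {0..1} \<tau> * p (y + \<tau> * h))"
  proof (cases "h = 0")
    case False
    from integrable_mult_indicator[OF _ lborel_integrable_real_affine[OF p False, of y], of "{0..1}"]
    show ?thesis by (simp add: mult.commute)
  qed auto
  have 1: "((\<lambda>\<tau>. indicator {0..1} \<tau> * p (y + \<tau> * h)) has_integral (LINT \<tau>|lborel. indicator {0..1} \<tau> * p (y + \<tau> * h))) UNIV"
    by (rule has_integral_integral_lborel[OF int])
  then have "((\<lambda>\<tau>. h * (indicator {0..1} \<tau> * p (y + \<tau> * h))) has_integral h * (LINT \<tau>|lborel. indicator {0..1} \<tau> * p (y + \<tau> * h))) UNIV"
    by (rule has_integral_mult_right)
  moreover have "((\<lambda>\<tau>. h * p (y + \<tau> * h)) has_integral (u (y + 1 * h) - u (y + 0 * h))) {0..1}"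
  proof (rule fundamental_theorem_of_calculus)
    fix x :: real
    have "((\<lambda>\<tau>. u (y + \<tau> * h)) has_real_derivative p (y + x * h) * h) (at x)"
      by (rule DERIV_chain2[where f=u, OF der]) (auto intro!: derivative_eq_intros)
    then show "((\<lambda>\<tau>. u (y + \<tau> * h)) has_vector_derivative h * p (y + x * h)) (at x within {0..1})"
      by (simp add: has_real_derivative_iff_has_vector_derivative mult.commute has_vector_derivative_at_within)
  qed simp
  then have "((\<lambda>\<tau>. if \<tau> \<in> {0..1} then h * p (y + \<tau> * h) else 0) has_integral (u (y + 1 * h) - u (y + 0 * h))) UNIV"
    by (subst has_integral_restrict_UNIV)
  then have "((\<lambda>\<tau>. h * (indicator {0..1} \<tau> * p (y + \<tau> * h))) has_integral (u (y + h) - u y)) UNIV"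
    by (rule back_subst[where P="\<lambda>g. (g has_integral _) UNIV", THEN back_subst[where P="\<lambda>I. (_ has_integral I) UNIV"]])
      (auto simp: indicator_def fun_eq_iff)
  ultimately show "u (y + h) - u y = h * (LINT \<tau>|lborel. indicator {0..1} \<tau> * p (y + \<tau> * h))"
    by (rule has_integral_unique[rotated])
qed

text \<open>
  With w(y) = \<open>\<alpha>\<close> y + c, the substitution y + \<open>\<sigma>\<close> w(y) is the inverse of y + t w(y); the case
  \<open>\<alpha>\<close> = 0 is a translation (a shear seen on one line), the case c = 0 a dilation about the origin.
\<close>

lemma affine_flow_params:
  fixes \<alpha> c t \<tau> :: real
  assumes "\<bar>\<alpha>\<bar> \<le> 1" "\<bar>t\<bar> \<le> 1/4" "0 \<le> \<tau>" "\<tau> \<le> 1"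
  defines "\<sigma> \<equiv> - t / (1 + \<alpha> * t)"
  shows "1 + \<alpha> * t \<ge> 3/4" "0 \<le> 1 / (1 + \<alpha> * t)" "1 / (1 + \<alpha> * t) \<le> 4/3"
    "\<bar>1 / (1 + \<alpha> * t) - 1\<bar> \<le> 2 * \<bar>t\<bar>" "\<bar>\<tau> * \<sigma>\<bar> \<le> 2 * \<bar>t\<bar>" "\<bar>\<tau> * \<sigma> * \<alpha>\<bar> \<le> 2 * \<bar>t\<bar>" "\<bar>\<tau> * \<sigma> * \<alpha>\<bar> \<le> 1/2"
proof -
  have at: "\<bar>\<alpha> * t\<bar> \<le> \<bar>t\<bar>" using assms(1) unfolding abs_mult by (intro mult_left_le_one_le) auto
  then show j: "1 + \<alpha> * t \<ge> 3/4" using assms(2) by linarith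
  then show "0 \<le> 1 / (1 + \<alpha> * t)" and l: "1 / (1 + \<alpha> * t) \<le> 4/3" by (auto simp: field_simps)
  have *: "\<bar>x / (1 + \<alpha> * t)\<bar> \<le> 2 * \<bar>t\<bar>" if "\<bar>x\<bar> \<le> \<bar>t\<bar>" for x
  proof -
    have "\<bar>x / (1 + \<alpha> * t)\<bar> = \<bar>x\<bar> * (1 / (1 + \<alpha> * t))" using j by (simp add: abs_divide)
    also have "\<dots> \<le> \<bar>t\<bar> * 2" using that l j by (intro mult_mono) auto
    finally show ?thesis by simp
  qed
  have "1 / (1 + \<alpha> * t) - 1 = - (\<alpha> * t) / (1 + \<alpha> * t)" using j by (simp add: field_simps)
  then show "\<bar>1 / (1 + \<alpha> * t) - 1\<bar> \<le> 2 * \<bar>t\<bar>" using *[of "- (\<alpha> * t)"] at by simp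
  have s: "\<bar>\<sigma>\<bar> \<le> 4/3 * \<bar>t\<bar>" 
  proof -
    have "\<bar>\<sigma>\<bar> = \<bar>t\<bar> * (1 / (1 + \<alpha> * t))" using j unfolding \<sigma>_def by (simp add: abs_divide)
    also have "\<dots> \<le> \<bar>t\<bar> * (4/3)" using l by (intro mult_left_mono) auto
    finally show ?thesis by simp
  qed
  have ts: "\<bar>\<tau> * \<sigma>\<bar> \<le> \<bar>\<sigma>\<bar>" unfolding abs_mult using assms(3,4) by (intro mult_left_le_one_le) auto
  then show "\<bar>\<tau> * \<sigma>\<bar> \<le> 2 * \<bar>t\<bar>" using s by linarith
  have tsa: "\<bar>\<tau> * \<sigma> * \<alpha>\<bar> \<le> \<bar>\<tau> * \<sigma>\<bar>" unfolding abs_mult using assms(1) by (intro mult_right_le_one_le) auto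
  show "\<bar>\<tau> * \<sigma> * \<alpha>\<bar> \<le> 2 * \<bar>t\<bar>" "\<bar>\<tau> * \<sigma> * \<alpha>\<bar> \<le> 1/2" using tsa ts s assms(2) by linarith+
qed

text \<open>Its point is the absence of c from the right-hand side: for a shear, c is the value of
  r(k) on the line and is unbounded across lines, so only this crude bound is common to all of
  them.\<close>

lemma affine_flow_L1_bound:
  fixes \<alpha> c t \<tau> :: real
  assumes [measurable]: "p \<in> borel_measurable borel" and "\<bar>\<alpha>\<bar> \<le> 1" "\<bar>t\<bar> \<le> 1/4" "0 \<le> \<tau>" "\<tau> \<le> 1"
  defines "\<sigma> \<equiv> - t / (1 + \<alpha> * t)"
  shows "(\<integral>\<^sup>+y. ennreal \<bar>p (y + \<tau> * (\<sigma> * (\<alpha> * y + c))) / (1 + \<alpha> * t) - p y\<bar> \<partial>lborel) \<le> 5 * (\<integral>\<^sup>+y. ennreal \<bar>p y\<bar> \<partial>lborel)"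
proof -
  note P = affine_flow_params[OF assms(2-5), folded \<sigma>_def]
  have "(\<integral>\<^sup>+y. ennreal \<bar>p (y + \<tau> * (\<sigma> * (\<alpha> * y + c))) / (1 + \<alpha> * t) - p y\<bar> \<partial>lborel) =
    L1_scaled_dist p (1 / (1 + \<alpha> * t)) (1 + \<tau> * \<sigma> * \<alpha>) (\<tau> * \<sigma> * c)"
    unfolding L1_scaled_dist_def by (simp add: algebra_simps)
  also have "\<dots> \<le> 5 * (\<integral>\<^sup>+y. ennreal \<bar>p y\<bar> \<partial>lborel)"
    using P by (intro L1_scaled_dist_bound) auto
  finally show ?thesis .
qed

lemma affine_flow_L1_small:
  fixes \<alpha> c :: real
  assumes p: "integrable lborel p" and \<alpha>: "\<bar>\<alpha>\<bar> \<le> 1" and \<eta>: "\<eta> > 0"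
  shows "\<forall>\<^sub>F t in nhds 0. \<forall>\<tau>\<in>{0..1}.
    (\<integral>\<^sup>+y. ennreal \<bar>p (y + \<tau> * (- t / (1 + \<alpha> * t) * (\<alpha> * y + c))) / (1 + \<alpha> * t) - p y\<bar> \<partial>lborel) \<le> ennreal \<eta>"
proof -
  obtain \<delta> where d: "\<delta> > 0" "\<delta> \<le> 1/2"
    "\<And>a b s. \<bar>a - 1\<bar> < \<delta> \<Longrightarrow> \<bar>b - 1\<bar> < \<delta> \<Longrightarrow> \<bar>s\<bar> < \<delta> \<Longrightarrow> L1_scaled_dist p a b s \<le> ennreal \<eta>"
    using L1_scaled_dist_small[OF p \<eta>] by metis
  \<comment> \<open>By \<open>affine_flow_params\<close> slope and factor move by at most 2 |t| and
    the offset by at most 2 |t| |c|; this \<epsilon> keeps all of them below \<delta>, and \<delta>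
    \<le> 1/2 yields the |t| \<le> 1/4 required there. The dependence on c makes the rate specific
    to the line.\<close>
  define \<epsilon> where "\<epsilon> = \<delta> / (2 * (1 + \<bar>c\<bar>))"
  have e: "\<epsilon> > 0" "\<epsilon> \<le> 1/4" "2 * \<epsilon> \<le> \<delta>" "2 * \<epsilon> * \<bar>c\<bar> \<le> \<delta>" 
    using d(1,2) unfolding \<epsilon>_def by (auto simp: field_simps mult_nonneg_nonneg intro: add_increasing2)
  show ?thesis
    unfolding eventually_nhds_metric
  proof (intro exI[of _ \<epsilon>] conjI e(1) allI impI ballI)
    fix t \<tau> :: real assume "dist t 0 < \<epsilon>" "\<tau> \<in> {0..1}"
    then have t: "\<bar>t\<bar> < \<epsilon>" "0 \<le> \<tau>" "\<tau> \<le> 1" by (auto simp: dist_real_def)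
    define \<sigma> where "\<sigma> = - t / (1 + \<alpha> * t)"
    have t4: "\<bar>t\<bar> \<le> 1/4" using t e by linarith
    note P = affine_flow_params[OF \<alpha> t4 t(2,3), folded \<sigma>_def]
    have "(\<integral>\<^sup>+y. ennreal \<bar>p (y + \<tau> * (\<sigma> * (\<alpha> * y + c))) / (1 + \<alpha> * t) - p y\<bar> \<partial>lborel) =
      L1_scaled_dist p (1 / (1 + \<alpha> * t)) (1 + \<tau> * \<sigma> * \<alpha>) (\<tau> * \<sigma> * c)"
      unfolding L1_scaled_dist_def by (simp add: algebra_simps)
    also have "\<dots> \<le> ennreal \<eta>"
    proof (intro d(3))
      show "\<bar>1 / (1 + \<alpha> * t) - 1\<bar> < \<delta>" using P(4) t(1) e(3) by linarith
      show "\<bar>1 + \<tau> * \<sigma> * \<alpha> - 1\<bar> < \<delta>" using P(6) t(1) e(3) by simp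
      have "\<bar>\<tau> * \<sigma> * c\<bar> \<le> 2 * \<bar>t\<bar> * \<bar>c\<bar>" unfolding abs_mult[of _ c] using P(5) by (intro mult_right_mono) auto
      also have "\<dots> < \<delta>"
      proof (cases "c = 0")
        case False
        then have "2 * \<bar>t\<bar> * \<bar>c\<bar> < 2 * \<epsilon> * \<bar>c\<bar>" using t(1) by simp
        then show ?thesis using e(4) by linarith
      qed (use d in auto)
      finally show "\<bar>\<tau> * \<sigma> * c\<bar> < \<delta>" .
    qed
    finally show "(\<integral>\<^sup>+y. ennreal \<bar>p (y + \<tau> * (- t / (1 + \<alpha> * t) * (\<alpha> * y + c))) / (1 + \<alpha> * t) - p y\<bar> \<partial>lborel) \<le> ennreal \<eta>"
      unfolding \<sigma>_def .
  qed
qed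

text \<open>
  With w(x) = \<open>\<alpha>\<close> x + c one has w(y + \<open>\<sigma>\<close> w(y)) = w(y) / (1 + \<open>\<alpha>\<close> t), so w(y) times the increment
  of f is an increment of w f.
\<close>

lemma affine_flow_error_pointwise:
  fixes f p :: "real \<Rightarrow> real" and \<alpha> c t :: real
  assumes der: "\<And>x. ((\<lambda>x. (\<alpha> * x + c) * f x) has_real_derivative p x) (at x)" and p: "integrable lborel p"
    and j: "1 + \<alpha> * t > 0" and y: "\<alpha> = 0 \<or> \<alpha> * y + c \<noteq> 0"
  defines "\<sigma> \<equiv> - t / (1 + \<alpha> * t)"
  shows "ennreal \<bar>f (y + \<sigma> * (\<alpha> * y + c)) / (1 + \<alpha> * t) - f y + t * p y\<bar> \<le>
    ennreal \<bar>t\<bar> * (\<integral>\<^sup>+\<tau>. indicator {0..1} \<tau> * ennreal \<bar>p (y + \<tau> * (\<sigma> * (\<alpha> * y + c))) / (1 + \<alpha> * t) - p y\<bar> \<partial>lborel)"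
proof (cases "\<alpha> * y + c = 0")
  case True
  \<comment> \<open>On such a line w f vanishes identically, so p = 0, and the point y does not
    move: the left-hand side is 0.\<close>
  then have "\<alpha> = 0" "c = 0" using y by auto
  with der[of y] have "((\<lambda>x. 0) has_real_derivative p y) (at y)" by simp
  then have "p y = 0" using DERIV_unique[OF _ DERIV_const] by blast
  with \<open>\<alpha> = 0\<close> \<open>c = 0\<close> show ?thesis by simp
next
  case False
  define w where "w = \<alpha> * y + c"
  define A where "A = (LINT \<tau>|lborel. indicator {0..1} \<tau> * p (y + \<tau> * (\<sigma> * w)))"
  have w: "w \<noteq> 0" using False w_def by simp
  note int = integral_FTC_unit_interval(1)[OF der p, of y "\<sigma> * w"]
  have "(\<alpha> * (y + \<sigma> * w) + c) * f (y + \<sigma> * w) - w * f y = \<sigma> * w * A"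
    using integral_FTC_unit_interval(2)[OF der p, of y "\<sigma> * w"] unfolding w_def A_def by simp
  moreover have "\<alpha> * (y + \<sigma> * w) + c = w / (1 + \<alpha> * t)"
    using j unfolding \<sigma>_def w_def by (simp add: field_simps)
  ultimately have "w / (1 + \<alpha> * t) * f (y + \<sigma> * w) - w * f y = \<sigma> * w * A" by simp
  then have "w * (f (y + \<sigma> * w) / (1 + \<alpha> * t) - f y - \<sigma> * A) = 0" by (simp add: algebra_simps)
  with w have "f (y + \<sigma> * w) / (1 + \<alpha> * t) - f y = \<sigma> * A" by simp
  \<comment> \<open>Since \<sigma> = - t / (1 + \<alpha> t), the Jacobian passes to the average A.
    This is where the factor in front of p in the L1 estimates originates.\<close>
  then have eq1: "f (y + \<sigma> * w) / (1 + \<alpha> * t) - f y + t * p y = - t * (A / (1 + \<alpha> * t) - p y)"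
    unfolding \<sigma>_def by (simp add: algebra_simps)
  have "A / (1 + \<alpha> * t) - p y = (LINT \<tau>|lborel. indicator {0..1} \<tau> * p (y + \<tau> * (\<sigma> * w)) / (1 + \<alpha> * t) - indicator {0..1} \<tau> * p y)"
    unfolding A_def using int by (subst Bochner_Integration.integral_diff) auto
  also have "\<dots> = (LINT \<tau>|lborel. indicator {0..1} \<tau> * (p (y + \<tau> * (\<sigma> * w)) / (1 + \<alpha> * t) - p y))"
    by (simp add: algebra_simps)
  finally have eq2: "A / (1 + \<alpha> * t) - p y = \<dots>" .
  have int2: "integrable lborel (\<lambda>\<tau>. indicator {0..1} \<tau> * (p (y + \<tau> * (\<sigma> * w)) / (1 + \<alpha> * t) - p y))"
  proof -
    have "integrable lborel (\<lambda>\<tau>. indicator {0..1} \<tau> * p (y + \<tau> * (\<sigma> * w)) / (1 + \<alpha> * t) - indicator {0..1} \<tau> * p y)"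
      using int by (intro Bochner_Integration.integrable_diff) auto
    then show ?thesis by (simp add: algebra_simps)
  qed
  have "ennreal \<bar>A / (1 + \<alpha> * t) - p y\<bar> \<le> (\<integral>\<^sup>+\<tau>. norm (indicator {0..1} \<tau> * (p (y + \<tau> * (\<sigma> * w)) / (1 + \<alpha> * t) - p y)) \<partial>lborel)"
    unfolding eq2 using integral_norm_bound_ennreal[OF int2] by simp
  also have "\<dots> = (\<integral>\<^sup>+\<tau>. indicator {0..1} \<tau> * ennreal \<bar>p (y + \<tau> * (\<sigma> * w)) / (1 + \<alpha> * t) - p y\<bar> \<partial>lborel)"
    by (intro nn_integral_cong) (auto simp: indicator_def)
  finally have le: "ennreal \<bar>A / (1 + \<alpha> * t) - p y\<bar> \<le> \<dots>" .
  show ?thesis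
    unfolding w_def[symmetric] eq1 abs_mult abs_minus using le by (simp add: ennreal_mult mult_left_mono)
qed

text \<open>Tonelli exchanges y with the averaging variable \<tau>, so a bound for each fixed \<tau>
  suffices. The zero of w, where one cannot divide, is a single point when \<alpha> \<noteq> 0 and
  hence null. C is left abstract because it is taken once as a small number and once as the
  dominating norm.\<close>

lemma affine_flow_error_le:
  fixes f p :: "real \<Rightarrow> real" and \<alpha> c t :: real and C :: ennreal
  assumes der: "\<And>x. ((\<lambda>x. (\<alpha> * x + c) * f x) has_real_derivative p x) (at x)" and p: "integrable lborel p"
    and j: "1 + \<alpha> * t > 0"
  defines "\<sigma> \<equiv> - t / (1 + \<alpha> * t)"
  assumes C: "\<And>\<tau>. 0 \<le> \<tau> \<Longrightarrow> \<tau> \<le> 1 \<Longrightarrow> (\<integral>\<^sup>+y. ennreal \<bar>p (y + \<tau> * (\<sigma> * (\<alpha> * y + c))) / (1 + \<alpha> * t) - p y\<bar> \<partial>lborel) \<le> C"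
  shows "(\<integral>\<^sup>+y. ennreal \<bar>f (y + \<sigma> * (\<alpha> * y + c)) / (1 + \<alpha> * t) - f y + t * p y\<bar> \<partial>lborel) \<le> ennreal \<bar>t\<bar> * C"
proof -
  have pm[measurable]: "p \<in> borel_measurable borel" using borel_measurable_integrable[OF p] by simp
  let ?g = "\<lambda>y \<tau>. ennreal \<bar>p (y + \<tau> * (\<sigma> * (\<alpha> * y + c))) / (1 + \<alpha> * t) - p y\<bar>"
  have "AE y in lborel. \<alpha> = 0 \<or> \<alpha> * y + c \<noteq> 0"
  proof (cases "\<alpha> = 0")
    case False
    have "AE y in lborel. y \<noteq> - c / \<alpha>" by (rule AE_lborel_singleton)
    then show ?thesis by eventually_elim (use False in \<open>auto simp: field_simps add_eq_0_iff\<close>)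
  qed simp
  then have "(\<integral>\<^sup>+y. ennreal \<bar>f (y + \<sigma> * (\<alpha> * y + c)) / (1 + \<alpha> * t) - f y + t * p y\<bar> \<partial>lborel) \<le>
    (\<integral>\<^sup>+y. ennreal \<bar>t\<bar> * (\<integral>\<^sup>+\<tau>. indicator {0..1} \<tau> * ?g y \<tau> \<partial>lborel) \<partial>lborel)"
    unfolding \<sigma>_def by (intro nn_integral_mono_AE, eventually_elim) (rule affine_flow_error_pointwise[OF der p j])
  also have "\<dots> = ennreal \<bar>t\<bar> * (\<integral>\<^sup>+y. (\<integral>\<^sup>+\<tau>. indicator {0..1} \<tau> * ?g y \<tau> \<partial>lborel) \<partial>lborel)"
    by (rule nn_integral_cmult) measurable
  also have "(\<integral>\<^sup>+y. (\<integral>\<^sup>+\<tau>. indicator {0..1} \<tau> * ?g y \<tau> \<partial>lborel) \<partial>lborel) = (\<integral>\<^sup>+\<tau>. (\<integral>\<^sup>+y. indicator {0..1} \<tau> * ?g y \<tau> \<partial>lborel) \<partial>lborel)"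
    by (rule lborel_pair.Fubini') measurable
  also have "\<dots> \<le> (\<integral>\<^sup>+\<tau>. indicator {0..1::real} \<tau> * C \<partial>lborel)"
  proof (intro nn_integral_mono)
    fix \<tau> :: real
    have "(\<integral>\<^sup>+y. indicator {0..1} \<tau> * ?g y \<tau> \<partial>lborel) = indicator {0..1} \<tau> * (\<integral>\<^sup>+y. ?g y \<tau> \<partial>lborel)"
      by (rule nn_integral_cmult) measurable
    also have "\<dots> \<le> indicator {0..1} \<tau> * C" using C[of \<tau>] by (auto simp: indicator_def)
    finally show "(\<integral>\<^sup>+y. indicator {0..1} \<tau> * ?g y \<tau> \<partial>lborel) \<le> indicator {0..1} \<tau> * C" .
  qed
  also have "\<dots> = C" by (simp add: nn_integral_multc)
  finally show ?thesis by (simp add: mult_left_mono)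
qed

subsection \<open>Shears of the product space\<close>

abbreviation LN :: "'i set \<Rightarrow> ('i \<Rightarrow> real) measure" where
  "LN I \<equiv> PiM I (\<lambda>_. lborel)"

interpretation lborel_product: product_sigma_finite "\<lambda>_. lborel :: real measure" ..

definition shear :: "'i \<Rightarrow> 'i \<Rightarrow> real \<Rightarrow> ('i \<Rightarrow> real) \<Rightarrow> 'i \<Rightarrow> real" where
  "shear k j t r = r(j := r j + t * r k)"

definition shear_jac :: "'i \<Rightarrow> 'i \<Rightarrow> real \<Rightarrow> real" where
  "shear_jac k j t = 1 + of_bool (j = k) * t"

text \<open>The transfer operator of the shear: if g is a density, this is the density of its image
  under \<open>shear k j t\<close>. The parameter - t / \<open>shear_jac k j t\<close> is that of
  the inverse map.\<close>

definition shear_op :: "'i \<Rightarrow> 'i \<Rightarrow> real \<Rightarrow> (('i \<Rightarrow> real) \<Rightarrow> real) \<Rightarrow> ('i \<Rightarrow> real) \<Rightarrow> real" where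
  "shear_op k j t g r = g (shear k j (- t / shear_jac k j t) r) / shear_jac k j t"

text \<open>The dictionary between the space and its lines: w(y) = \<alpha> y + c with \<alpha> =
  \<open>of_bool (j = k)\<close> and c = \<open>of_bool (j \<noteq> k) * x k\<close>. For j = k the
  point x, taken from the product over I - {j}, has the default value at k, and the factor in c
  discards it.\<close>

lemma shear_slice:
  "shear k j t (x(j := y)) = x(j := y + t * (of_bool (j = k) * y + of_bool (j \<noteq> k) * x k))"
  by (simp add: shear_def fun_eq_iff)

lemma shear_inverse:
  assumes "shear_jac k j t > 0"
  shows "shear k j (- t / shear_jac k j t) (shear k j t r) = r"
proof (cases "j = k")
  case True
  then have "shear_jac k j t = 1 + t" "1 + t > 0" using assms by (simp_all add: shear_jac_def)
  then have "(r k + t * r k) + (- t / shear_jac k j t) * (r k + t * r k) = r k"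
    by (simp add: field_simps)
  with True show ?thesis by (simp add: shear_def)
qed (simp add: shear_def shear_jac_def fun_eq_iff)

lemma measurable_shear [measurable]:
  assumes "j \<in> I" "k \<in> I"
  shows "shear k j t \<in> LN I \<rightarrow>\<^sub>M LN I"
  unfolding shear_def[abs_def]
proof (rule measurable_fun_upd[where J=I])
  show "(\<lambda>r. r j + t * r k) \<in> LN I \<rightarrow>\<^sub>M lborel" using assms by measurable
qed (use assms in auto)

lemma nn_integral_LN_slice:
  assumes I: "finite I" "j \<in> I" and \<psi>: "\<psi> \<in> borel_measurable (LN I)"
  shows "(\<integral>\<^sup>+r. \<psi> r \<partial>LN I) = (\<integral>\<^sup>+x. (\<integral>\<^sup>+y. \<psi> (x(j := y)) \<partial>lborel) \<partial>LN (I - {j}))"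
  using lborel_product.product_nn_integral_insert[of "I - {j}" j \<psi>] I \<psi> by (simp add: insert_absorb)

lemma measurable_slice:
  assumes "j \<in> I" "x \<in> space (LN (I - {j}))" "\<psi> \<in> LN I \<rightarrow>\<^sub>M N"
  shows "(\<lambda>y. \<psi> (x(j := y))) \<in> borel \<rightarrow>\<^sub>M N"
  using measurable_compose[OF measurable_component_update[OF assms(2), of j]] assms
  by (simp add: insert_absorb)

text \<open>Only coordinate j moves, so Tonelli reduces the Jacobian formula to a one-dimensional
  affine substitution on each line, with slope J and an offset that is constant along the
  line.\<close>

lemma nn_integral_shear:
  assumes I: "finite I" "j \<in> I" "k \<in> I" and \<psi>[measurable]: "\<psi> \<in> borel_measurable (LN I)"
    and t: "shear_jac k j t > 0"
  shows "(\<integral>\<^sup>+r. \<psi> (shear k j t r) \<partial>LN I) = ennreal (1 / shear_jac k j t) * (\<integral>\<^sup>+r. \<psi> r \<partial>LN I)"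
proof -
  have m: "(\<lambda>r. \<psi> (shear k j t r)) \<in> borel_measurable (LN I)"
    using measurable_compose[OF measurable_shear[OF I(2,3)] \<psi>] .
  define J where "J = shear_jac k j t"
  have J: "J > 0" using t by (simp add: J_def)
  have "(\<integral>\<^sup>+y. \<psi> (shear k j t (x(j := y))) \<partial>lborel) = ennreal (1 / J) * (\<integral>\<^sup>+y. \<psi> (x(j := y)) \<partial>lborel)"
    if x: "x \<in> space (LN (I - {j}))" for x
  proof -
    have "(\<integral>\<^sup>+y. \<psi> (x(j := y)) \<partial>lborel) =
      ennreal \<bar>J\<bar> * (\<integral>\<^sup>+y. \<psi> (x(j := t * (of_bool (j \<noteq> k) * x k) + J * y)) \<partial>lborel)"
      using J by (intro nn_integral_real_affine measurable_slice[OF I(2) x \<psi>]) auto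
    also have "\<dots> = ennreal J * (\<integral>\<^sup>+y. \<psi> (shear k j t (x(j := y))) \<partial>lborel)"
      using J unfolding shear_slice by (simp add: J_def shear_jac_def algebra_simps)
    finally show ?thesis using J by (simp add: mult.assoc[symmetric] ennreal_mult[symmetric])
  qed
  then have "(\<integral>\<^sup>+x. (\<integral>\<^sup>+y. \<psi> (shear k j t (x(j := y))) \<partial>lborel) \<partial>LN (I - {j})) =
    (\<integral>\<^sup>+x. ennreal (1 / J) * (\<integral>\<^sup>+y. \<psi> (x(j := y)) \<partial>lborel) \<partial>LN (I - {j}))"
    by (rule nn_integral_cong)
  also have "\<dots> = ennreal (1 / J) * (\<integral>\<^sup>+x. (\<integral>\<^sup>+y. \<psi> (x(j := y)) \<partial>lborel) \<partial>LN (I - {j}))"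
  proof (rule nn_integral_cmult)
    have "(\<lambda>(x, y). \<psi> (x(j := y))) \<in> borel_measurable (LN (I - {j}) \<Otimes>\<^sub>M lborel)"
      using measurable_compose[OF measurable_add_dim[of j "I - {j}" "\<lambda>_. lborel"], of \<psi>] I
      by (simp add: insert_absorb split_beta')
    then show "(\<lambda>x. \<integral>\<^sup>+y. \<psi> (x(j := y)) \<partial>lborel) \<in> borel_measurable (LN (I - {j}))"
      by (rule lborel.borel_measurable_nn_integral)
  qed
  finally show ?thesis
    unfolding J_def nn_integral_LN_slice[OF I(1,2) m] nn_integral_LN_slice[OF I(1,2) \<psi>] .
qed

lemma distr_shear:
  assumes I: "finite I" "j \<in> I" "k \<in> I" and t: "shear_jac k j t > 0"
  shows "distr (LN I) (LN I) (shear k j t) = density (LN I) (\<lambda>_. ennreal (1 / shear_jac k j t))"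
proof (rule measure_eqI)
  note [measurable] = measurable_shear[OF I(2,3)]
  fix A assume "A \<in> sets (distr (LN I) (LN I) (shear k j t))"
  then have A[measurable]: "A \<in> sets (LN I)" by simp
  have "emeasure (distr (LN I) (LN I) (shear k j t)) A = (\<integral>\<^sup>+r. indicator A r \<partial>distr (LN I) (LN I) (shear k j t))"
    by simp
  also have "\<dots> = (\<integral>\<^sup>+r. indicator A (shear k j t r) \<partial>LN I)"
    by (subst nn_integral_distr) auto
  also have "\<dots> = ennreal (1 / shear_jac k j t) * emeasure (LN I) A"
    by (subst nn_integral_shear[OF I _ t]) auto
  finally show "emeasure (distr (LN I) (LN I) (shear k j t)) A = emeasure (density (LN I) (\<lambda>_. ennreal (1 / shear_jac k j t))) A"
    by (simp add: emeasure_density_const)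
qed simp

lemma measurable_shear_op:
  assumes I: "j \<in> I" "k \<in> I" and g: "g \<in> borel_measurable (LN I)"
  shows "shear_op k j t g \<in> borel_measurable (LN I)"
  unfolding shear_op_def[abs_def]
  using measurable_compose[OF measurable_shear[OF I] g] by (intro borel_measurable_divide) auto

lemma shear_op_shear:
  assumes "shear_jac k j t > 0"
  shows "shear_op k j t g (shear k j t r) = g r / shear_jac k j t"
  unfolding shear_op_def shear_inverse[OF assms] ..

lemma integrable_shear_op:
  fixes g :: "('i \<Rightarrow> real) \<Rightarrow> real"
  assumes I: "finite I" "j \<in> I" "k \<in> I" and t: "shear_jac k j t > 0" and g: "integrable (LN I) g"
  shows "integrable (LN I) (shear_op k j t g)"
proof -
  note gm = measurable_shear_op[OF I(2,3) borel_measurable_integrable[OF g]]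
  have "integrable (LN I) (\<lambda>r. shear_op k j t g (shear k j t r))"
    unfolding shear_op_shear[OF t] using g by simp
  then have "integrable (distr (LN I) (LN I) (shear k j t)) (shear_op k j t g)"
    by (subst integrable_distr_eq[OF measurable_shear[OF I(2,3)] gm])
  then have "integrable (LN I) (\<lambda>r. (1 / shear_jac k j t) *\<^sub>R shear_op k j t g r)"
    unfolding distr_shear[OF I t] using t by (subst (asm) integrable_density) (use gm in auto)
  from integrable_mult_right[OF this, of "shear_jac k j t"] show ?thesis using t by simp
qed

lemma integral_shear:
  fixes g \<phi> :: "('i \<Rightarrow> real) \<Rightarrow> real"
  assumes I: "finite I" "j \<in> I" "k \<in> I" and t: "shear_jac k j t > 0"
    and g: "g \<in> borel_measurable (LN I)" and \<phi>: "\<phi> \<in> borel_measurable (LN I)"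
  shows "(LINT r|LN I. \<phi> (shear k j t r) * g r) = (LINT r|LN I. \<phi> r * shear_op k j t g r)"
proof -
  define J where "J = shear_jac k j t"
  have J: "J > 0" using t by (simp add: J_def)
  note gm[measurable] = measurable_shear_op[OF I(2,3) g]
  note \<phi>[measurable]
  \<comment> \<open>Writing g as J times \<open>shear_op k j t g\<close> at the sheared point turns
    the whole integrand into a function of that point, ready for the image measure.\<close>
  have "(LINT r|LN I. \<phi> (shear k j t r) * g r) = (LINT r|LN I. J * (\<phi> (shear k j t r) * shear_op k j t g (shear k j t r)))"
    unfolding shear_op_shear[OF t] using J by (simp add: J_def)
  also have "\<dots> = (LINT r|distr (LN I) (LN I) (shear k j t). J * (\<phi> r * shear_op k j t g r))"
    by (rule integral_distr[symmetric, OF measurable_shear[OF I(2,3)]]) measurable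
  also have "\<dots> = (LINT r|LN I. (1 / J) *\<^sub>R (J * (\<phi> r * shear_op k j t g r)))"
    unfolding distr_shear[OF I t] J_def[symmetric] using J by (subst integral_density) auto
  finally show ?thesis using J by simp
qed

section \<open>From single coordinate lines to L1 limits on the whole space\<close>

lemma tendsto_ennreal_zeroI:
  fixes f :: "'b \<Rightarrow> ennreal"
  assumes "\<And>\<eta>::real. \<eta> > 0 \<Longrightarrow> \<forall>\<^sub>F x in F. f x \<le> ennreal \<eta>"
  shows "(f \<longlongrightarrow> 0) F"
proof (rule order_tendstoI)
  fix a :: ennreal assume "0 < a"
  then obtain z where z: "0 < z" "z < a" using dense by blast
  then have "z = ennreal (enn2real z)" "enn2real z > 0"
    by (cases z; auto)+
  then show "\<forall>\<^sub>F x in F. f x < a"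
    using assms[of "enn2real z"] z by (auto elim!: eventually_mono)
qed simp

text \<open>Dominated convergence with the lines in direction j as points. The rate in
  \<open>lim\<close> may differ from line to line, while the constant C in \<open>bound\<close> is
  common. Lines on which W has infinite integral form a null set by Tonelli and are exempt from
  both.\<close>

lemma tendsto_nn_integral_slices:
  fixes H :: "real \<Rightarrow> ('i \<Rightarrow> real) \<Rightarrow> ennreal"
  assumes I: "finite I" "j \<in> I"
    and H: "\<And>t. H t \<in> borel_measurable (LN I)"
    and W: "W \<in> borel_measurable (LN I)" "(\<integral>\<^sup>+r. W r \<partial>LN I) < \<infinity>"
    and lim: "\<And>x. x \<in> space (LN (I - {j})) \<Longrightarrow> (\<integral>\<^sup>+y. W (x(j := y)) \<partial>lborel) < \<infinity> \<Longrightarrow>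
      ((\<lambda>t. \<integral>\<^sup>+y. H t (x(j := y)) \<partial>lborel) \<longlongrightarrow> 0) (at 0)"
    and bound: "\<And>x t. x \<in> space (LN (I - {j})) \<Longrightarrow> (\<integral>\<^sup>+y. W (x(j := y)) \<partial>lborel) < \<infinity> \<Longrightarrow> t \<noteq> 0 \<Longrightarrow> \<bar>t\<bar> \<le> 1/4 \<Longrightarrow>
      (\<integral>\<^sup>+y. H t (x(j := y)) \<partial>lborel) \<le> ennreal C * (\<integral>\<^sup>+y. W (x(j := y)) \<partial>lborel)"
  shows "((\<lambda>t. \<integral>\<^sup>+r. H t r \<partial>LN I) \<longlongrightarrow> 0) (at 0)"
  unfolding tendsto_at_iff_sequentially
proof (intro allI impI)
  fix X :: "nat \<Rightarrow> real" assume X: "\<forall>i. X i \<in> UNIV - {0}" "X \<longlonglongrightarrow> 0"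
  have slice_meas: "(\<lambda>x. \<integral>\<^sup>+y. \<psi> (x(j := y)) \<partial>lborel) \<in> borel_measurable (LN (I - {j}))"
    if "\<psi> \<in> borel_measurable (LN I)" for \<psi> :: "_ \<Rightarrow> ennreal"
  proof -
    have "(\<lambda>(x, y). \<psi> (x(j := y))) \<in> borel_measurable (LN (I - {j}) \<Otimes>\<^sub>M lborel)"
      using measurable_compose[OF measurable_add_dim[of j "I - {j}" "\<lambda>_. lborel"], of \<psi>] I that
      by (simp add: insert_absorb split_beta')
    then show ?thesis by (rule lborel.borel_measurable_nn_integral)
  qed
  have fin: "AE x in LN (I - {j}). (\<integral>\<^sup>+y. W (x(j := y)) \<partial>lborel) < \<infinity>"
    using nn_integral_PInf_AE[OF slice_meas[OF W(1)]] W(2) nn_integral_LN_slice[OF I W(1)]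
    by (auto simp: less_top[symmetric])
  \<comment> \<open>Domination is available only for |t| \<le> 1/4, so an initial segment of the
    sequence is dropped and restored at the end.\<close>
  from LIMSEQ_D[OF X(2), of "1/4"] obtain n0 where n0: "\<And>n. n \<ge> n0 \<Longrightarrow> \<bar>X n\<bar> < 1/4" by auto
  have "(\<lambda>n. \<integral>\<^sup>+x. (\<integral>\<^sup>+y. H (X (n + n0)) (x(j := y)) \<partial>lborel) \<partial>LN (I - {j})) \<longlonglongrightarrow> (\<integral>\<^sup>+x. 0 \<partial>LN (I - {j}))"
  proof (rule nn_integral_dominated_convergence[where w="\<lambda>x. ennreal C * (\<integral>\<^sup>+y. W (x(j := y)) \<partial>lborel)"])
    show "AE x in LN (I - {j}). (\<integral>\<^sup>+y. H (X (n + n0)) (x(j := y)) \<partial>lborel) \<le> ennreal C * (\<integral>\<^sup>+y. W (x(j := y)) \<partial>lborel)" for n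
      using fin AE_space
    proof eventually_elim
      case (elim x)
      show ?case using X(1) n0[of "n + n0"] by (intro bound elim) (auto simp: less_imp_le)
    qed
    show "AE x in LN (I - {j}). (\<lambda>n. \<integral>\<^sup>+y. H (X (n + n0)) (x(j := y)) \<partial>lborel) \<longlonglongrightarrow> 0"
      using fin AE_space
    proof eventually_elim
      case (elim x)
      from lim[OF elim(2,1)] X have "((\<lambda>t. \<integral>\<^sup>+y. H t (x(j := y)) \<partial>lborel) \<circ> X) \<longlonglongrightarrow> 0"
        unfolding tendsto_at_iff_sequentially by blast
      from LIMSEQ_ignore_initial_segment[OF this, of n0] show ?case by (simp add: o_def)
    qed
    have "(\<integral>\<^sup>+x. ennreal C * (\<integral>\<^sup>+y. W (x(j := y)) \<partial>lborel) \<partial>LN (I - {j})) = ennreal C * (\<integral>\<^sup>+r. W r \<partial>LN I)"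
      unfolding nn_integral_LN_slice[OF I W(1)] by (rule nn_integral_cmult[OF slice_meas[OF W(1)]])
    also have "\<dots> < \<infinity>" using W(2) by (simp add: ennreal_mult_less_top)
    finally show "(\<integral>\<^sup>+x. ennreal C * (\<integral>\<^sup>+y. W (x(j := y)) \<partial>lborel) \<partial>LN (I - {j})) < \<infinity>" .
  qed (use slice_meas[OF H] slice_meas[OF W(1)] in auto)
  then have "(\<lambda>n. \<integral>\<^sup>+r. H (X (n + n0)) r \<partial>LN I) \<longlonglongrightarrow> 0"
    unfolding nn_integral_LN_slice[OF I H] by simp
  then have "(\<lambda>n. \<integral>\<^sup>+r. H (X n) r \<partial>LN I) \<longlonglongrightarrow> 0" by (rule LIMSEQ_offset)
  then show "((\<lambda>t. \<integral>\<^sup>+r. H t r \<partial>LN I) \<circ> X) \<longlonglongrightarrow> 0" by (simp add: o_def)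
qed

lemma shear_op_slice:
  "shear_op k j t g (x(j := y)) =
    g (x(j := y + - t / (1 + of_bool (j = k) * t) * (of_bool (j = k) * y + of_bool (j \<noteq> k) * x k))) / (1 + of_bool (j = k) * t)"
  unfolding shear_op_def shear_slice unfolding shear_jac_def ..

lemma integrable_slice:
  fixes \<Phi> :: "('i \<Rightarrow> real) \<Rightarrow> real"
  assumes "j \<in> I" "x \<in> space (LN (I - {j}))" "\<Phi> \<in> borel_measurable (LN I)"
    "(\<integral>\<^sup>+y. ennreal \<bar>\<Phi> (x(j := y))\<bar> \<partial>lborel) < \<infinity>"
  shows "integrable lborel (\<lambda>y. \<Phi> (x(j := y)))"
  using measurable_slice[OF assms(1-3)] assms(4) by (simp add: integrable_iff_bounded)

text \<open>On each line \<open>shear_op\<close> is the endpoint \<tau> = 1 of the affine flow, so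
  both flow estimates apply directly.\<close>

lemma shear_op_tendsto_L1:
  fixes \<Phi> :: "('i \<Rightarrow> real) \<Rightarrow> real"
  assumes I: "finite I" "j \<in> I" "k \<in> I" and \<Phi>: "integrable (LN I) \<Phi>"
  shows "((\<lambda>t. \<integral>\<^sup>+r. ennreal \<bar>shear_op k j t \<Phi> r - \<Phi> r\<bar> \<partial>LN I) \<longlongrightarrow> 0) (at 0)"
proof (rule tendsto_nn_integral_slices[OF I(1,2), where W="\<lambda>r. ennreal \<bar>\<Phi> r\<bar>" and C=5])
  have \<Phi>m[measurable]: "\<Phi> \<in> borel_measurable (LN I)" using \<Phi> by simp
  note [measurable] = measurable_shear_op[OF I(2,3) \<Phi>m]
  show "(\<lambda>r. ennreal \<bar>shear_op k j t \<Phi> r - \<Phi> r\<bar>) \<in> borel_measurable (LN I)" for t by measurable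
  show "(\<lambda>r. ennreal \<bar>\<Phi> r\<bar>) \<in> borel_measurable (LN I)" by measurable
  show "(\<integral>\<^sup>+r. ennreal \<bar>\<Phi> r\<bar> \<partial>LN I) < \<infinity>" using \<Phi> by (simp add: integrable_iff_bounded)
  fix x assume x: "x \<in> space (LN (I - {j}))" "(\<integral>\<^sup>+y. ennreal \<bar>\<Phi> (x(j := y))\<bar> \<partial>lborel) < \<infinity>"
  define p where "p = (\<lambda>y. \<Phi> (x(j := y)))"
  define \<alpha> c :: real where "\<alpha> = of_bool (j = k)" and "c = of_bool (j \<noteq> k) * x k"
  have \<alpha>: "\<bar>\<alpha>\<bar> \<le> 1" by (simp add: \<alpha>_def)
  have p: "integrable lborel p" unfolding p_def by (rule integrable_slice[OF I(2) x(1) \<Phi>m x(2)])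
  have pm: "p \<in> borel_measurable borel" using borel_measurable_integrable[OF p] by simp
  have eq: "(\<integral>\<^sup>+y. ennreal \<bar>shear_op k j t \<Phi> (x(j := y)) - \<Phi> (x(j := y))\<bar> \<partial>lborel) =
    (\<integral>\<^sup>+y. ennreal \<bar>p (y + 1 * (- t / (1 + \<alpha> * t) * (\<alpha> * y + c))) / (1 + \<alpha> * t) - p y\<bar> \<partial>lborel)" for t
    unfolding shear_op_slice p_def \<alpha>_def c_def by simp
  show "((\<lambda>t. \<integral>\<^sup>+y. ennreal \<bar>shear_op k j t \<Phi> (x(j := y)) - \<Phi> (x(j := y))\<bar> \<partial>lborel) \<longlongrightarrow> 0) (at 0)"
  proof (rule tendsto_ennreal_zeroI)
    fix \<eta> :: real assume "\<eta> > 0"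
    note affine_flow_L1_small[OF p \<alpha> this, of c]
    then have "\<forall>\<^sub>F t in nhds 0. (\<integral>\<^sup>+y. ennreal \<bar>shear_op k j t \<Phi> (x(j := y)) - \<Phi> (x(j := y))\<bar> \<partial>lborel) \<le> ennreal \<eta>"
      unfolding eq by (rule eventually_mono) (erule bspec, simp)
    then show "\<forall>\<^sub>F t in at 0. (\<integral>\<^sup>+y. ennreal \<bar>shear_op k j t \<Phi> (x(j := y)) - \<Phi> (x(j := y))\<bar> \<partial>lborel) \<le> ennreal \<eta>"
      unfolding eventually_nhds_conv_at by (rule conjunct1)
  qed
  fix t :: real assume "\<bar>t\<bar> \<le> 1/4"
  from affine_flow_L1_bound[OF pm \<alpha> this, of 1 c]
  show "(\<integral>\<^sup>+y. ennreal \<bar>shear_op k j t \<Phi> (x(j := y)) - \<Phi> (x(j := y))\<bar> \<partial>lborel) \<le> 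
     ennreal 5 * (\<integral>\<^sup>+y. ennreal \<bar>\<Phi> (x(j := y))\<bar> \<partial>lborel)"
    by (simp only: eq p_def ennreal_numeral)
qed

text \<open>The quotient by |t| stands inside the integral, and still the majorant involves only
  |\<Phi>|: f enters the error through an increment of r(k) f, which is an integral of
  \<Phi>.\<close>

lemma shear_op_derivative_L1:
  fixes f \<Phi> :: "('i \<Rightarrow> real) \<Rightarrow> real"
  assumes I: "finite I" "j \<in> I" "k \<in> I" and \<Phi>: "integrable (LN I) \<Phi>"
    and fm[measurable]: "f \<in> borel_measurable (LN I)"
    and der: "\<And>r. r \<in> space (LN I) \<Longrightarrow> ((\<lambda>t. (r(j := t)) k * f (r(j := t))) has_real_derivative \<Phi> r) (at (r j))"
  shows "((\<lambda>t. \<integral>\<^sup>+r. ennreal (\<bar>shear_op k j t f r - f r + t * \<Phi> r\<bar> / \<bar>t\<bar>) \<partial>LN I) \<longlongrightarrow> 0) (at 0)"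
proof (rule tendsto_nn_integral_slices[OF I(1,2), where W="\<lambda>r. ennreal \<bar>\<Phi> r\<bar>" and C=5])
  have \<Phi>m[measurable]: "\<Phi> \<in> borel_measurable (LN I)" using \<Phi> by simp
  note [measurable] = measurable_shear_op[OF I(2,3) fm]
  show "(\<lambda>r. ennreal (\<bar>shear_op k j t f r - f r + t * \<Phi> r\<bar> / \<bar>t\<bar>)) \<in> borel_measurable (LN I)" for t by measurable
  show "(\<lambda>r. ennreal \<bar>\<Phi> r\<bar>) \<in> borel_measurable (LN I)" by measurable
  show "(\<integral>\<^sup>+r. ennreal \<bar>\<Phi> r\<bar> \<partial>LN I) < \<infinity>" using \<Phi> by (simp add: integrable_iff_bounded)
  fix x assume x: "x \<in> space (LN (I - {j}))" "(\<integral>\<^sup>+y. ennreal \<bar>\<Phi> (x(j := y))\<bar> \<partial>lborel) < \<infinity>"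
  define p where "p = (\<lambda>y. \<Phi> (x(j := y)))"
  define g where "g = (\<lambda>y. f (x(j := y)))"
  define \<alpha> c :: real where "\<alpha> = of_bool (j = k)" and "c = of_bool (j \<noteq> k) * x k"
  have \<alpha>: "\<bar>\<alpha>\<bar> \<le> 1" by (simp add: \<alpha>_def)
  have p: "integrable lborel p" unfolding p_def by (rule integrable_slice[OF I(2) x(1) \<Phi>m x(2)])
  have pm[measurable]: "p \<in> borel_measurable borel" using borel_measurable_integrable[OF p] by simp
  have gm[measurable]: "g \<in> borel_measurable borel" unfolding g_def by (rule measurable_slice[OF I(2) x(1) fm])
  have gder: "((\<lambda>y. (\<alpha> * y + c) * g y) has_real_derivative p y) (at y)" for y
  proof -
    have "x(j := y) \<in> space (LN I)" using x(1) I(2)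
      by (auto simp: space_PiM PiE_iff extensional_def)
    from der[OF this] show ?thesis
      unfolding p_def g_def \<alpha>_def c_def by (cases "j = k") auto
  qed
  define E where "E t y = \<bar>g (y + - t / (1 + \<alpha> * t) * (\<alpha> * y + c)) / (1 + \<alpha> * t) - g y + t * p y\<bar>" for t y
  \<comment> \<open>Used with C = \<eta> for the limit on a line and with C = 5 times the norm of
    the slice of \<Phi> for the domination.\<close>
  have slice: "(\<integral>\<^sup>+y. ennreal (\<bar>shear_op k j t f (x(j := y)) - f (x(j := y)) + t * \<Phi> (x(j := y))\<bar> / \<bar>t\<bar>) \<partial>lborel) \<le> C"
    if t: "t \<noteq> 0" "\<bar>t\<bar> \<le> 1/4" and
      C: "\<And>\<tau>. 0 \<le> \<tau> \<Longrightarrow> \<tau> \<le> 1 \<Longrightarrow> (\<integral>\<^sup>+y. ennreal \<bar>p (y + \<tau> * (- t / (1 + \<alpha> * t) * (\<alpha> * y + c))) / (1 + \<alpha> * t) - p y\<bar> \<partial>lborel) \<le> C"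
    for t C
  proof -
    have j: "1 + \<alpha> * t > 0" using affine_flow_params(1)[OF \<alpha> t(2), of 0] by simp
    have "(\<integral>\<^sup>+y. ennreal (\<bar>shear_op k j t f (x(j := y)) - f (x(j := y)) + t * \<Phi> (x(j := y))\<bar> / \<bar>t\<bar>) \<partial>lborel) =
      (\<integral>\<^sup>+y. ennreal (1 / \<bar>t\<bar>) * ennreal (E t y) \<partial>lborel)"
      unfolding shear_op_slice g_def p_def \<alpha>_def c_def E_def by (intro nn_integral_cong) (simp flip: ennreal_mult)
    also have "\<dots> = ennreal (1 / \<bar>t\<bar>) * (\<integral>\<^sup>+y. ennreal (E t y) \<partial>lborel)"
      unfolding E_def by (rule nn_integral_cmult) measurable
    also have "\<dots> \<le> ennreal (1 / \<bar>t\<bar>) * (ennreal \<bar>t\<bar> * C)"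
      unfolding E_def by (intro mult_left_mono affine_flow_error_le[OF gder p j] C) auto
    also have "\<dots> = C" using t by (simp add: mult.assoc[symmetric] ennreal_mult[symmetric])
    finally show ?thesis .
  qed
  show "((\<lambda>t. \<integral>\<^sup>+y. ennreal (\<bar>shear_op k j t f (x(j := y)) - f (x(j := y)) + t * \<Phi> (x(j := y))\<bar> / \<bar>t\<bar>) \<partial>lborel) \<longlongrightarrow> 0) (at 0)"
  proof (rule tendsto_ennreal_zeroI)
    fix \<eta> :: real assume "\<eta> > 0"
    have "\<forall>\<^sub>F t in at 0. \<forall>\<tau>\<in>{0..1}.
        (\<integral>\<^sup>+y. ennreal \<bar>p (y + \<tau> * (- t / (1 + \<alpha> * t) * (\<alpha> * y + c))) / (1 + \<alpha> * t) - p y\<bar> \<partial>lborel) \<le> ennreal \<eta>"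
      using affine_flow_L1_small[OF p \<alpha> \<open>\<eta> > 0\<close>, of c] unfolding eventually_nhds_conv_at by (rule conjunct1)
    moreover have "\<forall>\<^sub>F t in at (0::real). \<bar>t\<bar> \<le> 1/4 \<and> t \<noteq> 0"
      unfolding eventually_at by (rule exI[of _ "1/4"]) (simp add: dist_real_def)
    ultimately show "\<forall>\<^sub>F t in at 0. (\<integral>\<^sup>+y. ennreal (\<bar>shear_op k j t f (x(j := y)) - f (x(j := y)) + t * \<Phi> (x(j := y))\<bar> / \<bar>t\<bar>) \<partial>lborel) \<le> ennreal \<eta>"
    proof eventually_elim
      case (elim t)
      show ?case
      proof (rule slice)
        fix \<tau> :: real assume "0 \<le> \<tau>" "\<tau> \<le> 1"
        then show "(\<integral>\<^sup>+y. ennreal \<bar>p (y + \<tau> * (- t / (1 + \<alpha> * t) * (\<alpha> * y + c))) / (1 + \<alpha> * t) - p y\<bar> \<partial>lborel) \<le> ennreal \<eta>"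
          by (intro elim(1)[THEN bspec]) simp
      qed (use elim(2) in auto)
    qed
  qed
  fix t :: real assume t: "t \<noteq> 0" "\<bar>t\<bar> \<le> 1/4"
  show "(\<integral>\<^sup>+y. ennreal (\<bar>shear_op k j t f (x(j := y)) - f (x(j := y)) + t * \<Phi> (x(j := y))\<bar> / \<bar>t\<bar>) \<partial>lborel) \<le>
     ennreal 5 * (\<integral>\<^sup>+y. ennreal \<bar>\<Phi> (x(j := y))\<bar> \<partial>lborel)"
  proof (rule slice[OF t])
    fix \<tau> :: real assume "0 \<le> \<tau>" "\<tau> \<le> 1"
    from affine_flow_L1_bound[OF pm \<alpha> t(2) this, of c]
    show "(\<integral>\<^sup>+y. ennreal \<bar>p (y + \<tau> * (- t / (1 + \<alpha> * t) * (\<alpha> * y + c))) / (1 + \<alpha> * t) - p y\<bar> \<partial>lborel) \<le>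
        ennreal 5 * (\<integral>\<^sup>+y. ennreal \<bar>\<Phi> (x(j := y))\<bar> \<partial>lborel)"
      by (simp only: p_def ennreal_numeral)
  qed
qed

section \<open>Estimates uniform over bounded test functions\<close>

lemma eventually_nhds_of_at:
  "eventually P (at a) \<Longrightarrow> P a \<Longrightarrow> eventually P (nhds a)"
  unfolding eventually_nhds_conv_at by simp

lemma eventually_shear_jac_pos: "\<forall>\<^sub>F t in nhds 0. shear_jac k j t > 0"
proof -
  have "\<forall>\<^sub>F t in nhds (0::real). dist t 0 < 1" by (rule eventually_nhds_metric[THEN iffD2]) (auto intro: exI[of _ 1])
  then show ?thesis by eventually_elim (auto simp: shear_jac_def dist_real_def)
qed

lemma integrable_bounded_mult:
  fixes \<phi> g :: "'b \<Rightarrow> real"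
  assumes "integrable M g" "\<phi> \<in> borel_measurable M" "\<And>r. \<bar>\<phi> r\<bar> \<le> 1"
  shows "integrable M (\<lambda>r. \<phi> r * g r)"
  by (rule Bochner_Integration.integrable_bound[OF assms(1)])
    (use assms in \<open>auto simp: abs_mult intro!: mult_left_le_one_le\<close>)

lemma abs_integral_bounded_mult_le:
  fixes \<phi> h :: "'b \<Rightarrow> real"
  assumes "integrable M h" "\<phi> \<in> borel_measurable M" "\<And>r. \<bar>\<phi> r\<bar> \<le> 1"
    and le: "(\<integral>\<^sup>+r. ennreal \<bar>h r\<bar> \<partial>M) \<le> ennreal \<eta>" and \<eta>: "\<eta> \<ge> 0"
  shows "\<bar>LINT r|M. \<phi> r * h r\<bar> \<le> \<eta>"
proof -
  have "ennreal \<bar>LINT r|M. \<phi> r * h r\<bar> \<le> (\<integral>\<^sup>+r. norm (\<phi> r * h r) \<partial>M)"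
    using integral_norm_bound_ennreal[OF integrable_bounded_mult[OF assms(1-3)]] by simp
  also have "\<dots> \<le> (\<integral>\<^sup>+r. ennreal \<bar>h r\<bar> \<partial>M)"
    using assms(3) by (intro nn_integral_mono ennreal_leI) (auto simp: abs_mult intro!: mult_left_le_one_le)
  also note le
  finally show ?thesis using \<eta> by (simp add: ennreal_le_iff)
qed

text \<open>The quantifier over \<phi> stands inside \<open>eventually\<close> on purpose: the test
  functions inserted later depend on the same v that determines t. Uniformity holds because |\<phi>|
  \<le> 1 and the L1 distance does not involve \<phi>.\<close>

lemma eventually_integral_shear_continuous:
  fixes \<Phi> :: "('i \<Rightarrow> real) \<Rightarrow> real"
  assumes I: "finite I" "j \<in> I" "k \<in> I" and \<Phi>: "integrable (LN I) \<Phi>" and \<eta>: "\<eta> > 0"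
  shows "\<forall>\<^sub>F t in nhds 0. \<forall>\<phi> \<in> borel_measurable (LN I). (\<forall>r. \<bar>\<phi> r\<bar> \<le> 1) \<longrightarrow>
    \<bar>(LINT r|LN I. \<phi> (shear k j t r) * \<Phi> r) - (LINT r|LN I. \<phi> r * \<Phi> r)\<bar> \<le> \<eta>"
proof (rule eventually_nhds_of_at)
  have \<Phi>m: "\<Phi> \<in> borel_measurable (LN I)" using \<Phi> by simp
  have "\<forall>\<^sub>F t in at 0. (\<integral>\<^sup>+r. ennreal \<bar>shear_op k j t \<Phi> r - \<Phi> r\<bar> \<partial>LN I) < ennreal \<eta>"
    using order_tendstoD(2)[OF shear_op_tendsto_L1[OF I \<Phi>], of "ennreal \<eta>"] \<eta> by simp
  moreover have "\<forall>\<^sub>F t in at 0. shear_jac k j t > 0"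
    using eventually_shear_jac_pos by (rule eventually_nhds_conv_at[THEN iffD1, THEN conjunct1])
  ultimately show "\<forall>\<^sub>F t in at 0. \<forall>\<phi> \<in> borel_measurable (LN I). (\<forall>r. \<bar>\<phi> r\<bar> \<le> 1) \<longrightarrow>
    \<bar>(LINT r|LN I. \<phi> (shear k j t r) * \<Phi> r) - (LINT r|LN I. \<phi> r * \<Phi> r)\<bar> \<le> \<eta>"
  proof eventually_elim
    case (elim t)
    show ?case
    proof (intro ballI impI)
      fix \<phi> :: "_ \<Rightarrow> real" assume \<phi>: "\<phi> \<in> borel_measurable (LN I)" "\<forall>r. \<bar>\<phi> r\<bar> \<le> 1"
      note op = integrable_shear_op[OF I elim(2) \<Phi>]
      have "(LINT r|LN I. \<phi> (shear k j t r) * \<Phi> r) - (LINT r|LN I. \<phi> r * \<Phi> r) = (LINT r|LN I. \<phi> r * (shear_op k j t \<Phi> r - \<Phi> r))"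
        unfolding integral_shear[OF I elim(2) \<Phi>m \<phi>(1)] right_diff_distrib
        using op \<Phi> \<phi> by (subst Bochner_Integration.integral_diff) (auto intro!: integrable_bounded_mult)
      also have "\<bar>\<dots>\<bar> \<le> \<eta>"
        using op \<Phi> \<phi> elim(1) \<eta> by (intro abs_integral_bounded_mult_le) auto
      finally show "\<bar>(LINT r|LN I. \<phi> (shear k j t r) * \<Phi> r) - (LINT r|LN I. \<phi> r * \<Phi> r)\<bar> \<le> \<eta>" .
    qed
  qed
qed (use \<eta> in \<open>simp add: shear_def\<close>)

text \<open>The neighbourhood must include t = 0, since t will be a coordinate of v, and a
  coordinate of a nonzero v may vanish. For the same reason the error is stated as \<eta> |t| and
  not as a quotient.\<close>

lemma eventually_integral_shear_derivative:
  fixes f \<Phi> :: "('i \<Rightarrow> real) \<Rightarrow> real"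
  assumes I: "finite I" "j \<in> I" "k \<in> I" and \<Phi>: "integrable (LN I) \<Phi>" and f: "integrable (LN I) f" and \<eta>: "\<eta> > 0"
    and der: "\<And>r. r \<in> space (LN I) \<Longrightarrow> ((\<lambda>t. (r(j := t)) k * f (r(j := t))) has_real_derivative \<Phi> r) (at (r j))"
  shows "\<forall>\<^sub>F t in nhds 0. \<forall>\<phi> \<in> borel_measurable (LN I). (\<forall>r. \<bar>\<phi> r\<bar> \<le> 1) \<longrightarrow>
    \<bar>(LINT r|LN I. \<phi> (shear k j t r) * f r) - (LINT r|LN I. \<phi> r * f r) + t * (LINT r|LN I. \<phi> r * \<Phi> r)\<bar> \<le> \<eta> * \<bar>t\<bar>"
proof (rule eventually_nhds_of_at)
  have fm[measurable]: "f \<in> borel_measurable (LN I)" using f by simp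
  have [measurable]: "\<Phi> \<in> borel_measurable (LN I)" using \<Phi> by simp
  note [measurable] = measurable_shear_op[OF I(2,3) fm]
  have "\<forall>\<^sub>F t in at 0. (\<integral>\<^sup>+r. ennreal (\<bar>shear_op k j t f r - f r + t * \<Phi> r\<bar> / \<bar>t\<bar>) \<partial>LN I) < ennreal \<eta>"
    using order_tendstoD(2)[OF shear_op_derivative_L1[OF I \<Phi> fm der], of "ennreal \<eta>"] \<eta> by simp
  moreover have "\<forall>\<^sub>F t in at 0. shear_jac k j t > 0"
    using eventually_shear_jac_pos by (rule eventually_nhds_conv_at[THEN iffD1, THEN conjunct1])
  moreover have "\<forall>\<^sub>F t in at (0::real). t \<noteq> 0" by (rule eventually_neq_at_within)
  ultimately show "\<forall>\<^sub>F t in at 0. \<forall>\<phi> \<in> borel_measurable (LN I). (\<forall>r. \<bar>\<phi> r\<bar> \<le> 1) \<longrightarrow>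
    \<bar>(LINT r|LN I. \<phi> (shear k j t r) * f r) - (LINT r|LN I. \<phi> r * f r) + t * (LINT r|LN I. \<phi> r * \<Phi> r)\<bar> \<le> \<eta> * \<bar>t\<bar>"
  proof eventually_elim
    case (elim t)
    have "(\<integral>\<^sup>+r. ennreal \<bar>shear_op k j t f r - f r + t * \<Phi> r\<bar> \<partial>LN I) =
      (\<integral>\<^sup>+r. ennreal \<bar>t\<bar> * ennreal (\<bar>shear_op k j t f r - f r + t * \<Phi> r\<bar> / \<bar>t\<bar>) \<partial>LN I)"
      using elim(3) by (intro nn_integral_cong) (simp flip: ennreal_mult)
    also have "\<dots> = ennreal \<bar>t\<bar> * (\<integral>\<^sup>+r. ennreal (\<bar>shear_op k j t f r - f r + t * \<Phi> r\<bar> / \<bar>t\<bar>) \<partial>LN I)"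
      by (rule nn_integral_cmult) measurable
    also have "\<dots> \<le> ennreal \<bar>t\<bar> * ennreal \<eta>" using elim(1) by (intro mult_left_mono) auto
    finally have le: "(\<integral>\<^sup>+r. ennreal \<bar>shear_op k j t f r - f r + t * \<Phi> r\<bar> \<partial>LN I) \<le> ennreal (\<eta> * \<bar>t\<bar>)"
      using \<eta> by (simp flip: ennreal_mult add: mult.commute)
    show ?case
    proof (intro ballI impI)
      fix \<phi> :: "_ \<Rightarrow> real" assume \<phi>: "\<phi> \<in> borel_measurable (LN I)" "\<forall>r. \<bar>\<phi> r\<bar> \<le> 1"
      note op = integrable_shear_op[OF I elim(2) f]
      have i: "integrable (LN I) (\<lambda>r. \<phi> r * shear_op k j t f r)" "integrable (LN I) (\<lambda>r. \<phi> r * f r)"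
        "integrable (LN I) (\<lambda>r. \<phi> r * \<Phi> r)"
        using op f \<Phi> \<phi> by (auto intro!: integrable_bounded_mult)
      have "(LINT r|LN I. \<phi> r * (shear_op k j t f r - f r + t * \<Phi> r)) =
        (LINT r|LN I. \<phi> r * shear_op k j t f r - \<phi> r * f r + t * (\<phi> r * \<Phi> r))"
        by (simp add: algebra_simps)
      also have "\<dots> = (LINT r|LN I. \<phi> (shear k j t r) * f r) - (LINT r|LN I. \<phi> r * f r) + t * (LINT r|LN I. \<phi> r * \<Phi> r)"
        unfolding integral_shear[OF I elim(2) fm \<phi>(1)] using i by simp
      finally have eq: "(LINT r|LN I. \<phi> (shear k j t r) * f r) - (LINT r|LN I. \<phi> r * f r) + t * (LINT r|LN I. \<phi> r * \<Phi> r) =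
        (LINT r|LN I. \<phi> r * (shear_op k j t f r - f r + t * \<Phi> r))" ..
      show "\<bar>(LINT r|LN I. \<phi> (shear k j t r) * f r) - (LINT r|LN I. \<phi> r * f r) + t * (LINT r|LN I. \<phi> r * \<Phi> r)\<bar> \<le> \<eta> * \<bar>t\<bar>"
        unfolding eq using op f \<Phi> \<phi> \<eta> by (intro abs_integral_bounded_mult_le le) auto
    qed
  qed
qed (use \<eta> in \<open>simp add: shear_def\<close>)

subsection \<open>Simultaneous shears\<close>

definition mshear :: "'i \<Rightarrow> 'i set \<Rightarrow> ('i \<Rightarrow> real) \<Rightarrow> ('i \<Rightarrow> real) \<Rightarrow> 'i \<Rightarrow> real" where
  "mshear k J a r = (\<lambda>i. if i \<in> J then r i + a i * r k else r i)"

lemma mshear_empty [simp]: "mshear k {} a r = r"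
  by (simp add: mshear_def)

text \<open>The shear in j acts first. If it were the dilation j = k while J is nonempty, it would
  alter r k before the maps in J read it; the side condition excludes this.\<close>

lemma mshear_insert:
  assumes "j \<notin> J" "j \<noteq> k \<or> J = {}"
  shows "mshear k (insert j J) a r = mshear k J a (shear k j (a j) r)"
  using assms by (auto simp: mshear_def shear_def fun_eq_iff)

lemma measurable_mshear:
  assumes "J \<subseteq> I" "k \<in> I"
  shows "mshear k J a \<in> LN I \<rightarrow>\<^sub>M LN I"
  unfolding mshear_def[abs_def]
proof (rule measurable_PiM_single')
  show "(\<lambda>r. if i \<in> J then r i + a i * r k else r i) \<in> LN I \<rightarrow>\<^sub>M lborel" if "i \<in> I" for i
    using that assms by (cases "i \<in> J") auto
qed (use assms in \<open>auto simp: space_PiM PiE_iff extensional_def\<close>)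

text \<open>The index k is inserted first, since \<open>mshear_insert\<close> applies the dilation after the shears.\<close>

lemma mshear_induct [consumes 2, case_names empty insert]:
  assumes "finite J" "J \<subseteq> I" "P {}"
    and step: "\<And>j J. finite J \<Longrightarrow> j \<notin> J \<Longrightarrow> j \<in> I \<Longrightarrow> J \<subseteq> I \<Longrightarrow> j \<noteq> k \<or> J = {} \<Longrightarrow> P J \<Longrightarrow> P (insert j J)"
  shows "P J"
proof (cases "k \<in> J")
  case True
  have "P (insert k S)" if "finite S" "S \<subseteq> J - {k}" for S
    using that
  proof induction
    case empty
    show ?case using assms True by (intro step[where J="{}"]) auto
  next
    case (insert j S)
    then have "P (insert j (insert k S))" using assms(2) True by (intro step[where J="insert k S"]) auto
    then show ?case by (simp add: insert_commute)
  qed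
  from this[of "J - {k}"] assms(1) True show ?thesis by (simp add: insert_absorb)
next
  case False
  have "P S" if "finite S" "S \<subseteq> J" for S
    using that
  proof induction
    case (insert j S)
    then show ?case using assms(2) False by (intro step[where J=S]) auto
  qed (rule assms(3))
  with assms(1) show ?thesis by simp
qed

text \<open>When a further shear is added, its first-order coefficient is an integral of \<Phi>
  against an already sheared \<phi>. This limit permits replacing it by the integral against \<phi>
  itself.\<close>

lemma tendsto_integral_mshear:
  fixes \<Phi> \<phi> :: "('i \<Rightarrow> real) \<Rightarrow> real" and a :: "'v \<Rightarrow> 'i \<Rightarrow> real"
  assumes J: "finite J" "J \<subseteq> I" and I: "finite I" "k \<in> I" and \<Phi>: "integrable (LN I) \<Phi>"
    and \<phi>: "\<phi> \<in> borel_measurable (LN I)" "\<And>r. \<bar>\<phi> r\<bar> \<le> 1"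
    and a: "\<And>j. j \<in> I \<Longrightarrow> ((\<lambda>v. a v j) \<longlongrightarrow> 0) F"
  shows "((\<lambda>v. LINT r|LN I. \<phi> (mshear k J (a v) r) * \<Phi> r) \<longlongrightarrow> (LINT r|LN I. \<phi> r * \<Phi> r)) F"
  using J
proof (induction rule: mshear_induct[where k=k])
  case (insert j J)
  define D where "D v = (LINT r|LN I. \<phi> (mshear k J (a v) (shear k j (a v j) r)) * \<Phi> r)
    - (LINT r|LN I. \<phi> (mshear k J (a v) r) * \<Phi> r)" for v
  have "(D \<longlongrightarrow> 0) F"
  proof (rule tendstoI)
    fix e :: real assume "e > 0"
    then have e: "e / 2 > 0" by simp
    have "\<forall>\<^sub>F v in F. \<forall>\<phi> \<in> borel_measurable (LN I). (\<forall>r. \<bar>\<phi> r\<bar> \<le> 1) \<longrightarrow>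
      \<bar>(LINT r|LN I. \<phi> (shear k j (a v j) r) * \<Phi> r) - (LINT r|LN I. \<phi> r * \<Phi> r)\<bar> \<le> e / 2"
      using eventually_compose_filterlim[OF eventually_integral_shear_continuous[OF I(1) insert.hyps(3) I(2) \<Phi> e] a[OF insert.hyps(3)]] .
    then show "\<forall>\<^sub>F v in F. dist (D v) 0 < e"
    proof eventually_elim
      case (elim v)
      have "\<bar>D v\<bar> \<le> e / 2" unfolding D_def
        using elim[rule_format, of "\<lambda>r. \<phi> (mshear k J (a v) r)"] \<phi>
          measurable_compose[OF measurable_mshear[OF insert.hyps(4) I(2)] \<phi>(1)] by blast
      then show ?case using \<open>e > 0\<close> by (simp add: dist_real_def)
    qed
  qed
  from tendsto_add[OF this insert.IH] show ?case
    by (simp add: D_def mshear_insert[OF insert.hyps(2,5)])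
qed simp

lemma integral_mshear_derivative:
  fixes f \<phi> :: "('i \<Rightarrow> real) \<Rightarrow> real" and \<Phi> :: "'i \<Rightarrow> ('i \<Rightarrow> real) \<Rightarrow> real" and a :: "'v::real_normed_vector \<Rightarrow> 'i \<Rightarrow> real"
  assumes J: "finite J" "J \<subseteq> D" and I: "finite I" "k \<in> I" "D \<subseteq> I" and f: "integrable (LN I) f"
    and \<Phi>: "\<And>j. j \<in> D \<Longrightarrow> integrable (LN I) (\<Phi> j)"
    and der: "\<And>j r. j \<in> D \<Longrightarrow> r \<in> space (LN I) \<Longrightarrow> ((\<lambda>t. (r(j := t)) k * f (r(j := t))) has_real_derivative \<Phi> j r) (at (r j))"
    and \<phi>: "\<phi> \<in> borel_measurable (LN I)" "\<And>r. \<bar>\<phi> r\<bar> \<le> 1"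
    and a: "\<And>v j. \<bar>a v j\<bar> \<le> B j * norm v"
  shows "((\<lambda>v. ((LINT r|LN I. \<phi> (mshear k J (a v) r) * f r) - (LINT r|LN I. \<phi> r * f r)
    + (\<Sum>j\<in>J. a v j * (LINT r|LN I. \<phi> r * \<Phi> j r))) / norm v) \<longlongrightarrow> 0) (at 0)"
  using J
proof (induction rule: mshear_induct[where k=k])
  case (insert j J)
  note jD = insert.hyps(3)
  have jI: "j \<in> I" and JI: "J \<subseteq> I" using insert.hyps I(3) by auto
  have a0: "((\<lambda>v. a v i) \<longlongrightarrow> 0) (at 0)" for i
  proof (rule Lim_null_comparison)
    show "((\<lambda>v. B i * norm v) \<longlongrightarrow> 0) (at (0::'v))" by (intro tendsto_mult_right_zero tendsto_norm_zero tendsto_ident_at)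
  qed (use a in simp)
  define B' where "B' = \<bar>B j\<bar> + 1"
  have B': "B' > 0" by (simp add: B'_def)
  have aB: "\<bar>a v j\<bar> / norm v \<le> B'" if "v \<noteq> 0" for v
  proof -
    have "B j * norm v \<le> B' * norm v" by (intro mult_right_mono) (auto simp: B'_def)
    with a[of v j] have "\<bar>a v j\<bar> \<le> B' * norm v" by linarith
    then show ?thesis using that by (simp add: field_simps)
  qed
  define \<phi>' where "\<phi>' v r = \<phi> (mshear k J (a v) r)" for v r
  have \<phi>': "\<phi>' v \<in> borel_measurable (LN I)" for v
    unfolding \<phi>'_def using measurable_compose[OF measurable_mshear[OF JI I(2)] \<phi>(1)] .
  \<comment> \<open>X is the error of the single shear j, tested against the already sheared
    \<open>\<phi>' v\<close>. Y is the cost of having \<open>\<phi>' v\<close> instead of \<phi> in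
    the coefficient of a v j. The new error quotient is X plus the old one minus Y, and |a v j|
    \<le> B' norm v converts smallness relative to a v j into smallness relative to norm v.\<close>
  define X where "X v = ((LINT r|LN I. \<phi>' v (shear k j (a v j) r) * f r) - (LINT r|LN I. \<phi>' v r * f r) + a v j * (LINT r|LN I. \<phi>' v r * \<Phi> j r)) / norm v" for v
  define Y where "Y v = a v j / norm v * ((LINT r|LN I. \<phi>' v r * \<Phi> j r) - (LINT r|LN I. \<phi> r * \<Phi> j r))" for v
  have nz: "\<forall>\<^sub>F v in at (0::'v). v \<noteq> 0" by (rule eventually_neq_at_within)
  have X0: "(X \<longlongrightarrow> 0) (at 0)"
  proof (rule tendstoI)
    fix e :: real assume "e > 0"
    then have e: "e / (2 * B') > 0" using B' by simp
    have "\<forall>\<^sub>F v in at 0. \<forall>\<phi> \<in> borel_measurable (LN I). (\<forall>r. \<bar>\<phi> r\<bar> \<le> 1) \<longrightarrow>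
      \<bar>(LINT r|LN I. \<phi> (shear k j (a v j) r) * f r) - (LINT r|LN I. \<phi> r * f r) + a v j * (LINT r|LN I. \<phi> r * \<Phi> j r)\<bar> \<le> e / (2 * B') * \<bar>a v j\<bar>"
      using eventually_compose_filterlim[OF eventually_integral_shear_derivative[OF I(1) jI I(2) \<Phi>[OF jD] f e der[OF jD]] a0] .
    then show "\<forall>\<^sub>F v in at 0. dist (X v) 0 < e"
      using nz
    proof eventually_elim
      case (elim v)
      have "\<forall>r. \<bar>\<phi>' v r\<bar> \<le> 1" using \<phi>(2) by (simp add: \<phi>'_def)
      from elim(1)[THEN bspec, OF \<phi>', THEN mp, OF this]
      have "\<bar>X v\<bar> \<le> (e / (2 * B') * \<bar>a v j\<bar>) / norm v"
        unfolding X_def abs_divide abs_norm_cancel by (rule divide_right_mono) simp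
      also have "\<dots> = e / (2 * B') * (\<bar>a v j\<bar> / norm v)" by simp
      also have "\<dots> \<le> e / (2 * B') * B'" using e aB[OF elim(2)] by (intro mult_left_mono) auto
      also have "\<dots> = e / 2" using B' by simp
      finally show ?case using \<open>e > 0\<close> by (simp add: dist_real_def)
    qed
  qed
  have Y0: "(Y \<longlongrightarrow> 0) (at 0)"
  proof (rule Lim_null_comparison)
    have "((\<lambda>v. (LINT r|LN I. \<phi>' v r * \<Phi> j r) - (LINT r|LN I. \<phi> r * \<Phi> j r)) \<longlongrightarrow> 0) (at 0)"
      using tendsto_integral_mshear[OF insert.hyps(1) JI I(1,2) \<Phi>[OF jD] \<phi> a0] unfolding \<phi>'_def
      by (simp add: LIM_zero_iff)
    then show "((\<lambda>v. B' * \<bar>(LINT r|LN I. \<phi>' v r * \<Phi> j r) - (LINT r|LN I. \<phi> r * \<Phi> j r)\<bar>) \<longlongrightarrow> 0) (at 0)"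
      by (intro tendsto_mult_right_zero tendsto_rabs_zero)
    show "\<forall>\<^sub>F v in at 0. norm (Y v) \<le> B' * \<bar>(LINT r|LN I. \<phi>' v r * \<Phi> j r) - (LINT r|LN I. \<phi> r * \<Phi> j r)\<bar>"
      using nz
    proof eventually_elim
      case (elim v)
      show ?case unfolding Y_def real_norm_def abs_mult using aB[OF elim] by (intro mult_right_mono) auto
    qed
  qed
  have arith: "(A - P + \<alpha> * q) / n + (P - F + S) / n - \<alpha> / n * (q - q0) = (A - F + (\<alpha> * q0 + S)) / n"
    for A P \<alpha> q n F S q0 :: real
    by (simp add: diff_divide_distrib add_divide_distrib algebra_simps)
  have "X v + ((LINT r|LN I. \<phi> (mshear k J (a v) r) * f r) - (LINT r|LN I. \<phi> r * f r)
      + (\<Sum>j\<in>J. a v j * (LINT r|LN I. \<phi> r * \<Phi> j r))) / norm v - Y v =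
    ((LINT r|LN I. \<phi> (mshear k (insert j J) (a v) r) * f r) - (LINT r|LN I. \<phi> r * f r)
      + (\<Sum>j\<in>insert j J. a v j * (LINT r|LN I. \<phi> r * \<Phi> j r))) / norm v" for v
    unfolding X_def Y_def mshear_insert[OF insert.hyps(2,5)] \<phi>'_def sum.insert[OF insert.hyps(1,2)]
    by (rule arith)
  with tendsto_diff[OF tendsto_add[OF X0 insert.IH] Y0] show ?case by simp
qed simp

section \<open>Dual bases, the event as an integral, and the gradient formula\<close>

lemma dual_basis_expansion:
  fixes Z e :: "'i \<Rightarrow> 'b::euclidean_space"
  assumes "finite J" and span: "span (Z ` J) = UNIV"
    and dual: "\<And>i l. i \<in> J \<Longrightarrow> l \<in> J \<Longrightarrow> e i \<bullet> Z l = (if i = l then 1 else 0)"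
  shows "(\<Sum>i\<in>J. (e i \<bullet> v) *\<^sub>R Z i) = v" and "(\<Sum>i\<in>J. (Z i \<bullet> v) *\<^sub>R e i) = v"
proof -
  show "(\<Sum>i\<in>J. (e i \<bullet> v) *\<^sub>R Z i) = v"
  proof (rule linear_eq_on_span[where f="\<lambda>v. \<Sum>i\<in>J. (e i \<bullet> v) *\<^sub>R Z i" and g="\<lambda>v. v" and B="Z ` J"])
    show "linear (\<lambda>v. \<Sum>i\<in>J. (e i \<bullet> v) *\<^sub>R Z i)"
      by (intro linear_compose_sum ballI linearI) (auto simp: inner_add_right scaleR_add_left)
    show "v \<in> span (Z ` J)" using span by simp
    fix x assume "x \<in> Z ` J"
    then obtain l where l: "l \<in> J" "x = Z l" by auto
    have "(\<Sum>i\<in>J. (e i \<bullet> x) *\<^sub>R Z i) = (\<Sum>i\<in>J. if i = l then Z i else 0)"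
      using l dual by (intro sum.cong) auto
    then show "(\<Sum>i\<in>J. (e i \<bullet> x) *\<^sub>R Z i) = x" using l assms(1) by simp
  qed (rule linear_ident)
  \<comment> \<open>The difference of the two sides is orthogonal to every Z l, hence to the whole
    space and in particular to itself.\<close>
  have "orthogonal ((\<Sum>i\<in>J. (Z i \<bullet> v) *\<^sub>R e i) - v) x" for x
  proof (rule orthogonal_to_span[where S="Z ` J"])
    show "x \<in> span (Z ` J)" using span by simp
    fix y assume "y \<in> Z ` J"
    then obtain l where l: "l \<in> J" "y = Z l" by auto
    have "(\<Sum>i\<in>J. (Z i \<bullet> v) *\<^sub>R e i) \<bullet> y = (\<Sum>i\<in>J. if i = l then Z i \<bullet> v else 0)"
      unfolding inner_sum_left using l dual by (intro sum.cong) auto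
    also have "\<dots> = v \<bullet> y" using l assms(1) by (simp add: inner_commute)
    finally show "orthogonal ((\<Sum>i\<in>J. (Z i \<bullet> v) *\<^sub>R e i) - v) y"
      by (simp add: orthogonal_def inner_diff_left)
  qed
  from this[of "(\<Sum>i\<in>J. (Z i \<bullet> v) *\<^sub>R e i) - v"] show "(\<Sum>i\<in>J. (Z i \<bullet> v) *\<^sub>R e i) = v"
    by (simp add: orthogonal_self)
qed

text \<open>\<open>Phi\<close> is defined through \<open>deriv\<close>, which is meaningful only
  where a derivative exists. The factor r(k) is the identity or a constant along the line, so
  differentiability of f gives that of the product.\<close>

lemma Phi_has_real_derivative:
  assumes "(\<lambda>t. f (r(j := t))) differentiable (at (r j))"
  shows "((\<lambda>t. (r(j := t)) k * f (r(j := t))) has_real_derivative Phi f k j r) (at (r j))"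
proof -
  have "(\<lambda>t. (r(j := t)) k) differentiable (at (r j))" by (cases "j = k") auto
  then have "(\<lambda>t. (r(j := t)) k * f (r(j := t))) differentiable (at (r j))"
    using assms by (rule differentiable_mult)
  then show ?thesis
    unfolding Phi_def pderiv_coord_def using DERIV_deriv_iff_real_differentiable by blast
qed

lemma measurable_linear_combination:
  fixes Z :: "'i \<Rightarrow> 'b::euclidean_space"
  assumes "A \<subseteq> I"
  shows "(\<lambda>r. \<Sum>i\<in>A. r i *\<^sub>R Z i) \<in> borel_measurable (LN I)"
proof (intro borel_measurable_sum borel_measurable_scaleR borel_measurable_const)
  show "(\<lambda>r. r i) \<in> borel_measurable (LN I)" if "i \<in> A" for i
    using measurable_component_singleton[of i I "\<lambda>_. lborel :: real measure"] that assms by auto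
qed

lemma hfun_eq_integral_mshear:
  fixes Z e :: "nat \<Rightarrow> 'b::euclidean_space"
  assumes M: "prob_space M" and f: "distributed M (RN N) \<xi> (\<lambda>r. ennreal (f r))" "\<And>r. r \<in> space (RN N) \<Longrightarrow> f r \<ge> 0"
    and Q[measurable]: "Q \<in> sets borel" and k: "k \<in> {1..N}" and J: "J \<subseteq> {1..N}"
    and v: "(\<Sum>i\<in>J. a i *\<^sub>R Z i) = v"
  shows "hfun M \<xi> N Q Z k (Z k + v) =
    (LINT r|LN {1..N}. indicator Q (\<Sum>i\<in>{1..N}. mshear k J a r i *\<^sub>R Z i) * f r)"
proof -
  interpret prob_space M by fact
  have \<xi>[measurable]: "\<xi> \<in> M \<rightarrow>\<^sub>M LN {1..N}"
    using distributed_measurable[OF f(1)] unfolding RN_def .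
  have sum_eq: "(\<Sum>i\<in>{1..N}. r i *\<^sub>R (Z(k := Z k + v)) i) = (\<Sum>i\<in>{1..N}. mshear k J a r i *\<^sub>R Z i)" for r
  proof -
    have "(\<Sum>i\<in>{1..N}. r i *\<^sub>R (Z(k := Z k + v)) i) = (\<Sum>i\<in>{1..N}. r i *\<^sub>R Z i + (if i = k then r k *\<^sub>R v else 0))"
      by (intro sum.cong) (auto simp: scaleR_add_right)
    also have "\<dots> = (\<Sum>i\<in>{1..N}. r i *\<^sub>R Z i) + r k *\<^sub>R v"
      using k by (simp add: sum.distrib)
    also have "r k *\<^sub>R v = (\<Sum>i\<in>J. (a i * r k) *\<^sub>R Z i)"
      unfolding v[symmetric] by (simp add: scaleR_sum_right mult.commute)
    also have "\<dots> = (\<Sum>i\<in>{1..N}. if i \<in> J then (a i * r k) *\<^sub>R Z i else 0)"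
      using J by (simp add: sum.If_cases Int_absorb1)
    also have "(\<Sum>i\<in>{1..N}. r i *\<^sub>R Z i) + \<dots> = (\<Sum>i\<in>{1..N}. mshear k J a r i *\<^sub>R Z i)"
      unfolding sum.distrib[symmetric] by (intro sum.cong) (auto simp: mshear_def scaleR_add_left)
    finally show ?thesis .
  qed
  let ?W = "Z(k := Z k + v)"
  have S[measurable]: "(\<lambda>r. \<Sum>i\<in>{1..N}. r i *\<^sub>R ?W i) \<in> borel_measurable (LN {1..N})"
    by (rule measurable_linear_combination) simp
  have gm: "(\<lambda>r. indicator Q (\<Sum>i\<in>{1..N}. r i *\<^sub>R ?W i) :: real) \<in> borel_measurable (RN N)"
    unfolding RN_def by measurable
  have "{\<omega> \<in> space M. (\<Sum>i\<in>{1..N}. \<xi> \<omega> i *\<^sub>R ?W i) \<in> Q} \<in> sets M"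
    using measurable_sets_Collect[OF measurable_compose[OF \<xi> S], of "\<lambda>x. x \<in> Q"] by simp
  then have "hfun M \<xi> N Q Z k (Z k + v) = (LINT \<omega>|M. indicator {\<omega> \<in> space M. (\<Sum>i\<in>{1..N}. \<xi> \<omega> i *\<^sub>R ?W i) \<in> Q} \<omega>)"
    unfolding hfun_def gfun_def by simp
  also have "\<dots> = (LINT \<omega>|M. indicator Q (\<Sum>i\<in>{1..N}. \<xi> \<omega> i *\<^sub>R ?W i))"
    by (intro Bochner_Integration.integral_cong) (auto simp: indicator_def)
  also have "\<dots> = (LINT r|RN N. f r * indicator Q (\<Sum>i\<in>{1..N}. r i *\<^sub>R ?W i))"
    by (rule distributed_integral[OF f(1) gm f(2), symmetric])
  finally show ?thesis unfolding sum_eq by (simp add: RN_def mult.commute)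
qed

theorem theorem2:
  fixes M :: "'a measure" and \<xi> :: "'a \<Rightarrow> nat \<Rightarrow> real"
    and f :: "(nat \<Rightarrow> real) \<Rightarrow> real"
    and Q :: "(real ^ 'n) set" and N k :: nat
    and Z e :: "nat \<Rightarrow> real ^ 'n"
  assumes "prob_space M"
    and "distributed M (RN N) \<xi> (\<lambda>r. ennreal (f r))"
    and "\<forall>r \<in> space (RN N). f r \<ge> 0"
    and "Q \<in> sets borel"
    and "N \<ge> CARD('n)"
    and "k \<in> {1..N}"
    and "inj_on Z {1..CARD('n)}"
    and "independent (Z ` {1..CARD('n)})"
    and "span (Z ` {1..CARD('n)}) = UNIV"
    and "\<forall>j \<in> {1..CARD('n)}. \<forall>r \<in> space (RN N). (\<lambda>t. f (r(j := t))) differentiable (at (r j))"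
    and "\<forall>j \<in> {1..CARD('n)}. integrable (RN N) (Phi f k j)"
    and "\<forall>i \<in> {1..CARD('n)}. \<forall>l \<in> {1..CARD('n)}. e i \<bullet> Z l = (if i = l then 1 else 0)"
  shows "hfun M \<xi> N Q Z k differentiable (at (Z k))
    \<and> (hfun M \<xi> N Q Z k has_derivative
         (\<lambda>v. (\<Sum>j\<in>{1..CARD('n)}. \<Sum>i\<in>{1..CARD('n)}.
                 (dir_deriv (hfun M \<xi> N Q Z k) (Z k) (Z j) * (e j \<bullet> e i)) *\<^sub>R Z i) \<bullet> v))
       (at (Z k))"
proof -
  interpret prob_space M by fact
  let ?J = "{1..CARD('n)}"
  note Q[measurable] = \<open>Q \<in> sets borel\<close>
  have J: "?J \<subseteq> {1..N}" using \<open>N \<ge> CARD('n)\<close> by auto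
  have fnn: "f r \<ge> 0" if "r \<in> space (RN N)" for r using assms(3) that by blast
  have dual: "e i \<bullet> Z l = (if i = l then 1 else 0)" if "i \<in> ?J" "l \<in> ?J" for i l using assms(12) that by blast
  note expand = dual_basis_expansion[OF finite_atLeastAtMost assms(9) dual]
  define \<phi> :: "(nat \<Rightarrow> real) \<Rightarrow> real" where "\<phi> r = indicator Q (\<Sum>i\<in>{1..N}. r i *\<^sub>R Z i)" for r
  have \<phi>: "\<phi> \<in> borel_measurable (LN {1..N})"
  proof -
    have [measurable]: "(\<lambda>r. \<Sum>i\<in>{1..N}. r i *\<^sub>R Z i) \<in> borel_measurable (LN {1..N})"
      by (rule measurable_linear_combination) simp
    show ?thesis unfolding \<phi>_def[abs_def] by measurable
  qed
  have \<phi>1: "\<bar>\<phi> r\<bar> \<le> 1" for r by (simp add: \<phi>_def indicator_def)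
  \<comment> \<open>The constant 1 is integrable on the probability space; read through the density,
    this says that f is integrable.\<close>
  have fi: "integrable (LN {1..N}) f"
    using distributed_integrable[OF assms(2), of "\<lambda>_. 1"] fnn by (simp add: RN_def)
  define h where "h = hfun M \<xi> N Q Z k"
  define a where "a v j = e j \<bullet> v" for v :: "real^'n" and j
  \<comment> \<open>This is the value of the directional derivative along Z j, as \<open>dir\<close>
    confirms once differentiability is known; L is the candidate derivative in the coordinates a v
    j.\<close>
  define d where "d j = - (LINT r|LN {1..N}. \<phi> r * Phi f k j r)" for j
  define L where "L v = (\<Sum>j\<in>?J. a v j * d j)" for v
  have h_eq: "h (Z k + v) = (LINT r|LN {1..N}. \<phi> (mshear k ?J (a v) r) * f r)" for v
    unfolding h_def \<phi>_def a_def
    by (rule hfun_eq_integral_mshear[OF assms(1,2) fnn Q assms(6) J expand(1)])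
  have h0: "h (Z k) = (LINT r|LN {1..N}. \<phi> r * f r)"
    using h_eq[of 0] by (simp add: a_def mshear_def cong: if_cong)
  have lim: "((\<lambda>v. ((LINT r|LN {1..N}. \<phi> (mshear k ?J (a v) r) * f r) - (LINT r|LN {1..N}. \<phi> r * f r)
    + (\<Sum>j\<in>?J. a v j * (LINT r|LN {1..N}. \<phi> r * Phi f k j r))) / norm v) \<longlongrightarrow> 0) (at 0)"
  proof (rule integral_mshear_derivative[where D="?J" and B="\<lambda>j. norm (e j)"])
    show "integrable (LN {1..N}) (Phi f k j)" if "j \<in> ?J" for j
      using assms(11) that unfolding RN_def by blast
    show "((\<lambda>t. (r(j := t)) k * f (r(j := t))) has_real_derivative Phi f k j r) (at (r j))"
      if "j \<in> ?J" "r \<in> space (LN {1..N})" for j r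
      using assms(10) that unfolding RN_def by (intro Phi_has_real_derivative) blast
    show "\<bar>a v j\<bar> \<le> norm (e j) * norm v" for v j
      unfolding a_def by (rule Cauchy_Schwarz_ineq2)
  qed (use J assms(6) fi \<phi> \<phi>1 in auto)
  have hder: "(h has_derivative L) (at (Z k))"
    unfolding has_derivative_at
  proof
    show "bounded_linear L"
      unfolding L_def[abs_def] a_def
      by (intro bounded_linear_sum bounded_linear_mult_const bounded_linear_inner_right)
    have "(\<lambda>v. norm (h (Z k + v) - h (Z k) - L v) / norm v) = (\<lambda>v. \<bar>((LINT r|LN {1..N}. \<phi> (mshear k ?J (a v) r) * f r) - (LINT r|LN {1..N}. \<phi> r * f r)
      + (\<Sum>j\<in>?J. a v j * (LINT r|LN {1..N}. \<phi> r * Phi f k j r))) / norm v\<bar>)"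
      unfolding h_eq h0 L_def d_def by (simp add: sum_negf abs_divide)
    then show "(\<lambda>v. norm (h (Z k + v) - h (Z k) - L v) / norm v) \<midarrow>0\<rightarrow> 0"
      using tendsto_rabs_zero[OF lim] by simp
  qed
  have LZ: "L (Z j) = d j" if "j \<in> ?J" for j
  proof -
    have "L (Z j) = (\<Sum>i\<in>?J. if i = j then d i else 0)"
      unfolding L_def a_def using dual that by (intro sum.cong) auto
    then show ?thesis using that by simp
  qed
  have dir: "dir_deriv h (Z k) (Z j) = d j" if "j \<in> ?J" for j
  proof -
    have "((\<lambda>\<epsilon>::real. Z k + \<epsilon> *\<^sub>R Z j) has_derivative (\<lambda>\<epsilon>. \<epsilon> *\<^sub>R Z j)) (at 0)"
      by (auto intro!: derivative_eq_intros)
    moreover have "(h has_derivative L) (at (Z k + 0 *\<^sub>R Z j))" using hder by simp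
    ultimately have "((\<lambda>\<epsilon>. h (Z k + \<epsilon> *\<^sub>R Z j)) has_derivative (\<lambda>\<epsilon>. L (\<epsilon> *\<^sub>R Z j))) (at 0)"
      by (rule has_derivative_compose)
    moreover have "(\<lambda>\<epsilon>. L (\<epsilon> *\<^sub>R Z j)) = (*) (d j)"
      using linear_scale[OF has_derivative_linear[OF hder]] LZ[OF that] by (auto simp: fun_eq_iff)
    ultimately show ?thesis
      unfolding dir_deriv_def by (intro DERIV_imp_deriv) (simp add: has_field_derivative_def)
  qed
  \<comment> \<open>Paired with v, the inner sum over i becomes e j applied to the sum of (Z i
    \<bullet> v) e i, which is v by the second dual expansion. The Gram coefficients e j \<bullet> e
    i thus only rewrite the sum of d j e j in the basis Z.\<close>
  have "(\<Sum>j\<in>?J. \<Sum>i\<in>?J. (dir_deriv h (Z k) (Z j) * (e j \<bullet> e i)) *\<^sub>R Z i) \<bullet> v = L v" for v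
  proof -
    have "(\<Sum>j\<in>?J. \<Sum>i\<in>?J. (dir_deriv h (Z k) (Z j) * (e j \<bullet> e i)) *\<^sub>R Z i) \<bullet> v =
      (\<Sum>j\<in>?J. d j * (e j \<bullet> (\<Sum>i\<in>?J. (Z i \<bullet> v) *\<^sub>R e i)))"
      unfolding inner_sum_left inner_sum_right sum_distrib_left
      by (intro sum.cong refl) (simp add: dir)
    also have "(\<Sum>i\<in>?J. (Z i \<bullet> v) *\<^sub>R e i) = v" by (rule expand(2))
    also have "(\<Sum>j\<in>?J. d j * (e j \<bullet> v)) = L v" unfolding L_def a_def by (simp add: mult.commute)
    finally show ?thesis .
  qed
  then have "(h has_derivative (\<lambda>v. (\<Sum>j\<in>?J. \<Sum>i\<in>?J. (dir_deriv h (Z k) (Z j) * (e j \<bullet> e i)) *\<^sub>R Z i) \<bullet> v)) (at (Z k))"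
    using hder by simp
  then show ?thesis
    unfolding h_def differentiable_def by blast
qed

end
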